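(* Let $(\Gamma,\Sigma)$ be a nontrivial graph pair, where $\Gamma$ is (non-bipartite and) factor-loopless and $\Sigma$ is bipartite. Then $(\Gamma,\Sigma)$ is stable if and only if $\Gamma$ is stable.
   Context: All graphs are finite, undirected, without multiple edges, and loopless unless loops are explicitly allowed. An automorphism of a graph is a permutation of its vertices preserving adjacency and non-adjacency. The direct product $\Gamma\times\Sigma$ has vertex set $V(\Gamma)\times V(\Sigma)$, with $(u,v)$ adjacent to $(x,y)$ if and only if $u$ is adjacent to $x$ in $\Gamma$ and $v$ is adjacent to $y$ in $\Sigma$. The group $\mathrm{Aut}(\Gamma)\times\mathrm{Aut}(\Sigma)$ embeds in $\mathrm{Aut}(\Gamma\times\Sigma)$ by acting componentwise. The pair $(\Gamma,\Sigma)$ is stable if $\mathrm{Aut}(\Gamma\times\Sigma)=\mathrm{Aut}(\Gamma)\times\mathrm{Aut}(\Sigma)$ (under this embedding), and unstable otherwise. A graph $\Gamma$ is stable if the pair $(\Gamma,K_2)$ is stable. A graph is twin-free if no two distinct vertices have the same neighbourhood. Graphs $\Gamma,\Sigma$ are coprime (with respect to the direct product) if there is no graph $\Delta$ of order greater than $1$ such that $\Gamma\cong\Gamma'\times\Delta$ and $\Sigma\cong\Sigma'\times\Delta$ for some graphs $\Gamma',\Sigma'$; here $\Delta,\Gamma',\Sigma'$ may have loops. A graph pair $(\Gamma,\Sigma)$ is nontrivial if $\Gamma$ and $\Sigma$ are coprime connected twin-free graphs and exactly one of them is bipartite. A graph is bipartite if its vertices can be 2-coloured so that no edge is monochromatic;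 the bipartite member of a nontrivial pair is understood to have two nonempty partite sets (at least one edge). A graph (loops allowed) is prime with respect to the direct product if it has more than one vertex and, whenever it is isomorphic to $A\times B$ with $A,B$ graphs possibly having loops, one of $A,B$ has exactly one vertex. Every connected non-bipartite graph has a unique factorization into primes (loops allowed in the factors), up to order and isomorphism. A connected non-bipartite twin-free graph $\Gamma$ with direct-prime factorization $\Gamma\cong\Gamma_1\times\cdots\times\Gamma_n$ (in the category where loops are allowed) is factor-loopless if each $\Gamma_i$ is loopless. *)

theory Defs
  imports "Graph_Theory.Graph_Theory" "HOL-Combinatorics.Permutations"
begin

text \<open>
  Graphs are symmetric relations on a finite vertex set: \<open>pair_graph\<close> is a finite simple graph
  and \<open>pair_pseudo_graph\<close> a finite graph in which loops are allowed (an undirected edge is a pair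
  of opposite arcs, a loop a single arc). Connectedness and isomorphism are the notions of
  \<open>Graph_Theory\<close>, applied through the coercion \<open>with_proj\<close>. In particular a connected graph
  has a vertex.
\<close>

definition automorphisms :: "'a pair_pre_digraph \<Rightarrow> ('a \<Rightarrow> 'a) set" where
  "automorphisms G = {f. f permutes pverts G \<and>
     (\<forall>u \<in> pverts G. \<forall>v \<in> pverts G. (f u, f v) \<in> parcs G \<longleftrightarrow> (u, v) \<in> parcs G)}"

definition direct_product ::
    "'a pair_pre_digraph \<Rightarrow> 'b pair_pre_digraph \<Rightarrow> ('a \<times> 'b) pair_pre_digraph"  (infixr "\<times>\<^sub>g" 80) where
  "G \<times>\<^sub>g H = \<lparr> pverts = pverts G \<times> pverts H,
     parcs = {((u, v), (x, y)) | u v x y. (u, x) \<in> parcs G \<and> (v, y) \<in> parcs H} \<rparr>"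

text \<open>
  The componentwise action. Permutations (\<open>permutes\<close>) are the identity outside the set they
  permute, so the pair of maps is applied on the vertices of the product only.
\<close>

definition componentwise ::
    "'a pair_pre_digraph \<Rightarrow> 'b pair_pre_digraph \<Rightarrow> ('a \<Rightarrow> 'a) \<Rightarrow> ('b \<Rightarrow> 'b) \<Rightarrow> 'a \<times> 'b \<Rightarrow> 'a \<times> 'b" where
  "componentwise G H f g = (\<lambda>p. if p \<in> pverts (G \<times>\<^sub>g H) then map_prod f g p else p)"

definition stable_pair :: "'a pair_pre_digraph \<Rightarrow> 'b pair_pre_digraph \<Rightarrow> bool" where
  "stable_pair G H \<longleftrightarrow>
     automorphisms (G \<times>\<^sub>g H) =
       {componentwise G H f g | f g. f \<in> automorphisms G \<and> g \<in> automorphisms H}"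

definition K2 :: "bool pair_pre_digraph" where
  "K2 = \<lparr> pverts = UNIV, parcs = {(a, b). a \<noteq> b} \<rparr>"

definition stable_graph :: "'a pair_pre_digraph \<Rightarrow> bool" where
  "stable_graph G \<longleftrightarrow> stable_pair G K2"

definition neighbourhood :: "'a pair_pre_digraph \<Rightarrow> 'a \<Rightarrow> 'a set" where
  "neighbourhood G u = {v \<in> pverts G. (u, v) \<in> parcs G}"

definition twin_free :: "'a pair_pre_digraph \<Rightarrow> bool" where
  "twin_free G \<longleftrightarrow>
     (\<forall>u \<in> pverts G. \<forall>v \<in> pverts G. u \<noteq> v \<longrightarrow> neighbourhood G u \<noteq> neighbourhood G v)"

definition bipartite :: "'a pair_pre_digraph \<Rightarrow> bool" where
  "bipartite G \<longleftrightarrow> (\<exists>c :: 'a \<Rightarrow> bool. \<forall>(u, v) \<in> parcs G. c u \<noteq> c v)"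

text \<open>
  Quantification over all finite graphs (up to isomorphism) is quantification over the finite
  graphs whose vertices are natural numbers.
\<close>

definition graph_coprime :: "'a pair_pre_digraph \<Rightarrow> 'b pair_pre_digraph \<Rightarrow> bool" where
  "graph_coprime G H \<longleftrightarrow>
     \<not> (\<exists>(D :: nat pair_pre_digraph) (G' :: nat pair_pre_digraph) (H' :: nat pair_pre_digraph).
          pair_pseudo_graph D \<and> pair_pseudo_graph G' \<and> pair_pseudo_graph H' \<and>
          card (pverts D) > 1 \<and>
          digraph_iso (with_proj G) (with_proj (G' \<times>\<^sub>g D)) \<and>
          digraph_iso (with_proj H) (with_proj (H' \<times>\<^sub>g D)))"

text \<open>
  \<open>K\<^sub>1\<close> is edgeless, hence bipartite by the colouring condition alone; the requirement that the
  bipartite member has an edge makes both its partite sets nonempty.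
\<close>

definition nontrivial_pair :: "'a pair_pre_digraph \<Rightarrow> 'b pair_pre_digraph \<Rightarrow> bool" where
  "nontrivial_pair G H \<longleftrightarrow>
     pair_graph G \<and> pair_graph H \<and>
     graph_coprime G H \<and>
     connected (with_proj G) \<and> connected (with_proj H) \<and>
     twin_free G \<and> twin_free H \<and>
     bipartite G \<noteq> bipartite H \<and>
     (bipartite G \<longrightarrow> parcs G \<noteq> {}) \<and> (bipartite H \<longrightarrow> parcs H \<noteq> {})"

definition direct_prime :: "'a pair_pre_digraph \<Rightarrow> bool" where
  "direct_prime G \<longleftrightarrow>
     pair_pseudo_graph G \<and> card (pverts G) > 1 \<and>
     (\<forall>(A :: nat pair_pre_digraph) (B :: nat pair_pre_digraph).
        pair_pseudo_graph A \<and> pair_pseudo_graph B \<and>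
        digraph_iso (with_proj G) (with_proj (A \<times>\<^sub>g B)) \<longrightarrow>
        card (pverts A) = 1 \<or> card (pverts B) = 1)"

text \<open>
  The product of a list of graphs; vertices are lists of vertices. The empty product is the
  unit of the direct product, a single vertex with a loop.
\<close>

definition direct_product_list :: "'a pair_pre_digraph list \<Rightarrow> 'a list pair_pre_digraph" where
  "direct_product_list Gs =
     \<lparr> pverts = {us. list_all2 (\<lambda>u G. u \<in> pverts G) us Gs},
       parcs = {(us, vs). length us = length Gs \<and> length vs = length Gs \<and>
                  (\<forall>i < length Gs. (us ! i, vs ! i) \<in> parcs (Gs ! i))} \<rparr>"

definition prime_factorization_of :: "nat pair_pre_digraph list \<Rightarrow> 'a pair_pre_digraph \<Rightarrow> bool" where
  "prime_factorization_of Gs G \<longleftrightarrow>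
     (\<forall>P \<in> set Gs. direct_prime P) \<and>
     digraph_iso (with_proj G) (with_proj (direct_product_list Gs))"

text \<open>
  The notion is meant for connected non-bipartite twin-free graphs. Such a graph has a prime
  factorization (split until all factors are prime), which is unique up to order and isomorphism
  of the factors; as looplessness is isomorphism invariant, the quantifier below ranges over
  the versions of that single factorization.
\<close>

definition factor_loopless :: "'a pair_pre_digraph \<Rightarrow> bool" where
  "factor_loopless G \<longleftrightarrow>
     (\<forall>Gs. prime_factorization_of Gs G \<longrightarrow> (\<forall>P \<in> set Gs. pair_loopfree_digraph P))"

end

theory Submission
  imports Defs
begin

text \<open>
  Split an automorphism \<open>\<phi>\<close> of \<open>\<Gamma> \<times> \<Sigma>\<close> along the bipartition of \<open>\<Sigma>\<close>. The arcs between the two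
  sides form a connected thin relation between two sets, and the projections before and after \<open>\<phi>\<close>
  are two product decompositions of it. By means of the Cartesian skeleton of one side, any two
  decompositions of such a relation have a common refinement. Hence \<open>\<Gamma>\<close>, read as a relation
  between two copies of its vertex set, is the product of the part of \<open>\<Gamma>\<close> fixed by \<open>\<phi>\<close> and a part
  exchanged with \<open>\<Sigma>\<close>.

  A product decomposition of the relation \<open>\<Gamma>\<close> need not be one of the graph \<open>\<Gamma>\<close>: it may treat the
  two copies differently. Refining it with its own transpose isolates the discrepancy as a
  factor \<open>R \<times> R\<^sup>T\<close>, which has a loop. So if \<open>\<Gamma>\<close> is factor-loopless, the exchanged part is a graph
  that divides both \<open>\<Gamma>\<close> and \<open>\<Sigma>\<close>, and coprimality makes it trivial. Then \<open>\<phi>\<close> acts on the first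
  coordinate by one permutation per side, and stability of \<open>\<Gamma>\<close> says that the two are equal.
\<close>

section \<open>Rectangular bands and Cartesian steps\<close>

text \<open>The product of \<open>G\<close> and \<open>H\<close> is bipartite, and connected
  bipartite graphs do not factor uniquely into primes, so \<open>\<phi>\<close> cannot be read off
  from prime factors. Decomposing the relation between the two colour classes, with rows and columns
  treated independently, restores a refinement theorem. The price is that whatever is learnt about
  \<open>G\<close> comes in two versions, one for each colour of \<open>H\<close>;
  factor-looplessness is used exactly to make them agree. Decompositions are handled as binary
  operations, because common refinement then becomes an equation, the interchange law. The
  decomposition seen after \<open>\<phi>\<close> is the conjugate of the one seen before it, and
  transposing the relation merely swaps the operation on rows with the one on columns. The
  interchange law also lets both operations on the product descend to single factors: to
  \<open>opG\<close> on \<open>G\<close> and, within each colour class, to \<open>opH\<close> on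
  \<open>H\<close>.\<close>

text \<open>
  A product decomposition of \<open>U\<close> is encoded by the operation that takes the first coordinate from
  \<open>x\<close> and the second from \<open>y\<close>. Thus \<open>n x y = y\<close> says that \<open>x\<close> and \<open>y\<close> have the same first
  coordinate, and \<open>n x y = x\<close> that they have the same second one.
\<close>

definition rect_band :: "'u set \<Rightarrow> ('u \<Rightarrow> 'u \<Rightarrow> 'u) \<Rightarrow> bool" where
  "rect_band U n \<longleftrightarrow>
     (\<forall>x\<in>U. \<forall>y\<in>U. n x y \<in> U) \<and> (\<forall>x\<in>U. n x x = x) \<and>
     (\<forall>x\<in>U. \<forall>y\<in>U. \<forall>z\<in>U. n (n x y) z = n x z \<and> n x (n y z) = n x z)"

lemma rect_bandD:
  assumes "rect_band U n"
  shows "x \<in> U \<Longrightarrow> y \<in> U \<Longrightarrow> n x y \<in> U"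
    and "x \<in> U \<Longrightarrow> n x x = x"
    and "x \<in> U \<Longrightarrow> y \<in> U \<Longrightarrow> z \<in> U \<Longrightarrow> n (n x y) z = n x z"
    and "x \<in> U \<Longrightarrow> y \<in> U \<Longrightarrow> z \<in> U \<Longrightarrow> n x (n y z) = n x z"
  using assms unfolding rect_band_def by blast+

lemma rect_band_opp: "rect_band U n \<Longrightarrow> rect_band U (\<lambda>x y. n y x)"
  unfolding rect_band_def by blast

text \<open>The interchange law. For two rectangular bands it amounts to a common refinement into
  four factors, each indexed by one coordinate of \<open>n\<close> and one of
  \<open>m\<close>.\<close>

definition commuting_on :: "'u set \<Rightarrow> ('u \<Rightarrow> 'u \<Rightarrow> 'u) \<Rightarrow> ('u \<Rightarrow> 'u \<Rightarrow> 'u) \<Rightarrow> bool" where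
  "commuting_on U n m \<longleftrightarrow>
     (\<forall>x\<in>U. \<forall>x'\<in>U. \<forall>y\<in>U. \<forall>y'\<in>U. m (n x x') (n y y') = n (m x y) (m x' y'))"

lemma commuting_onD:
  "commuting_on U n m \<Longrightarrow> x \<in> U \<Longrightarrow> x' \<in> U \<Longrightarrow> y \<in> U \<Longrightarrow> y' \<in> U \<Longrightarrow>
     m (n x x') (n y y') = n (m x y) (m x' y')"
  unfolding commuting_on_def by blast

text \<open>Makes \<open>S\<close> the edge relation of a Cartesian product along \<open>n\<close>:
  a step moves one coordinate only, and it can be carried to every value of the coordinate that
  stays fixed.\<close>

definition cartesian_for :: "'u set \<Rightarrow> ('u \<Rightarrow> 'u \<Rightarrow> bool) \<Rightarrow> ('u \<Rightarrow> 'u \<Rightarrow> 'u) \<Rightarrow> bool" where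
  "cartesian_for U S n \<longleftrightarrow> rect_band U n \<and>
     (\<forall>x y. S x y \<longrightarrow> n x y = y \<or> n x y = x) \<and>
     (\<forall>x y. \<forall>t\<in>U. S x y \<and> n x y = y \<longrightarrow> S (n t x) (n t y)) \<and>
     (\<forall>x y. \<forall>t\<in>U. S x y \<and> n x y = x \<longrightarrow> S (n x t) (n y t))"

lemma cartesian_forD:
  assumes "cartesian_for U S n"
  shows "rect_band U n"
    and "S x y \<Longrightarrow> n x y = y \<or> n x y = x"
    and "S x y \<Longrightarrow> n x y = y \<Longrightarrow> t \<in> U \<Longrightarrow> S (n t x) (n t y)"
    and "S x y \<Longrightarrow> n x y = x \<Longrightarrow> t \<in> U \<Longrightarrow> S (n x t) (n y t)"
  using assms unfolding cartesian_for_def by blast+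

section \<open>Cartesian structures on one connected step relation commute\<close>

locale connected_steps =
  fixes U :: "'u set" and S :: "'u \<Rightarrow> 'u \<Rightarrow> bool"
  assumes step_in: "S x y \<Longrightarrow> x \<in> U \<and> y \<in> U"
    and step_neq: "S x y \<Longrightarrow> x \<noteq> y"
    and step_sym: "S x y \<Longrightarrow> S y x"
    and steps: "x \<in> U \<Longrightarrow> y \<in> U \<Longrightarrow> S\<^sup>*\<^sup>* x y"
begin

lemma cartesian_for_opp: 
  assumes "cartesian_for U S n" shows "cartesian_for U S (\<lambda>x y. n y x)"
  unfolding cartesian_for_def
proof (intro conjI allI ballI impI)
  note C = cartesian_forD[OF assms]
  note R = rect_bandD[OF C(1)]
  show "rect_band U (\<lambda>x y. n y x)" by (rule rect_band_opp[OF C(1)])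
  show "n y x = y \<or> n y x = x" if "S x y" for x y
    using C(2)[OF step_sym[OF that]] by blast
  show "S (n x t) (n y t)" if "t \<in> U" "S x y \<and> n y x = y" for x y t
    using C(4)[OF step_sym] that step_sym by metis
  show "S (n t x) (n t y)" if "t \<in> U" "S x y \<and> n y x = x" for x y t
    using C(3)[OF step_sym] that step_sym by metis
qed

text \<open>Project the path to the layer through \<open>t\<close>: a step in the second coordinate
  survives, a step in the first one collapses to a point.\<close>

lemma steps_in_layer:
  assumes n: "cartesian_for U S n" and "t \<in> U" "S\<^sup>*\<^sup>* x y" "x \<in> U"
  shows "(\<lambda>u v. S u v \<and> n u v = v)\<^sup>*\<^sup>* (n t x) (n t y)"
  using assms(3,4)
proof (induction rule: rtranclp_induct)
  case (step y z)
  note C = cartesian_forD[OF n]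
  note R = rect_bandD[OF C(1)]
  have yz: "y \<in> U" "z \<in> U" using step_in step by blast+
  show ?case
  proof (cases "n y z = z")
    case True
    have "S (n t y) (n t z)" by (rule C(3)[OF step(2) True \<open>t \<in> U\<close>])
    moreover have "n (n t y) (n t z) = n t z" using R yz \<open>t \<in> U\<close> by metis
    ultimately show ?thesis using step by (simp add: rtranclp.rtrancl_into_rtrancl)
  next
    case False
    then have "n y z = y" using C(2) step by blast
    then have "n t y = n t z" using R yz \<open>t \<in> U\<close> by metis
    then show ?thesis using step by simp
  qed
qed auto

text \<open>Opposite edges of a 4-cycle move the same factor. If \<open>v v'\<close> moved the first
  coordinate while \<open>u u'\<close> moves the second, comparing coordinates around the cycle
  would force \<open>u' = v\<close>, \<open>u = v'\<close> or \<open>u = u'\<close>.\<close>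

lemma square:
  assumes n: "cartesian_for U S n"
    and S: "S u u'" "S u v" "S u' v'" "S v v'" and "n u u' = u'" "u' \<noteq> v" "u \<noteq> v'"
  shows "n v v' = v'"
proof (rule ccontr)
  assume neq: "n v v' \<noteq> v'"
  note C = cartesian_forD[OF n]
  note R = rect_bandD[OF C(1)]
  have [simp]: "u \<in> U" "u' \<in> U" "v \<in> U" "v' \<in> U" using step_in S by auto
  have vv: "n v v' = v" using C(2)[OF S(4)] neq by blast
  show False
  proof (cases "n u v = v")
    case True
    then have "n u' v' \<noteq> v'" using R vv neq \<open>n u u' = u'\<close>
      by (metis \<open>u \<in> U\<close> \<open>u' \<in> U\<close> \<open>v \<in> U\<close> \<open>v' \<in> U\<close>)
    then have "n u' v' = u'" using C(2)[OF S(3)] by blast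
    then have "u' = v"
      using R vv True \<open>n u u' = u'\<close> by (metis \<open>u \<in> U\<close> \<open>u' \<in> U\<close> \<open>v \<in> U\<close> \<open>v' \<in> U\<close>)
    then show False using \<open>u' \<noteq> v\<close> by blast
  next
    case False
    then have uv: "n u v = u" using C(2)[OF S(2)] by blast
    from C(2)[OF S(3)] show False
    proof
      assume "n u' v' = v'"
      then have "u = v'" using uv vv R \<open>n u u' = u'\<close>
        by (metis \<open>u \<in> U\<close> \<open>u' \<in> U\<close> \<open>v \<in> U\<close> \<open>v' \<in> U\<close>)
      then show False using \<open>u \<noteq> v'\<close> by blast
    next
      assume "n u' v' = u'"
      then have "u = u'" using uv vv R \<open>n u u' = u'\<close>
        by (metis \<open>u \<in> U\<close> \<open>u' \<in> U\<close> \<open>v \<in> U\<close> \<open>v' \<in> U\<close>)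
      then show False using step_neq[OF S(1)] by blast
    qed
  qed
qed

text \<open>Slide the step \<open>u u'\<close> along the path. Two consecutive rungs
  \<open>y, m u' y\<close> and \<open>z, m u' z\<close> bound a 4-cycle, and \<open>square\<close>
  hands the \<open>n\<close>-direction from one rung to the next. The diagonals are distinct because
  rungs and rails move different \<open>m\<close>-coordinates.\<close>

lemma translated_step:
  assumes n: "cartesian_for U S n" and m: "cartesian_for U S m"
    and S: "S u u'" and nu: "n u u' = u'" and mu: "m u u' = u"
    and path: "(\<lambda>u v. S u v \<and> m u v = v)\<^sup>*\<^sup>* u y"
  shows "m u y = y \<and> n y (m u' y) = m u' y"
  using path
proof (induction rule: rtranclp_induct)
  case base
  note R = rect_bandD[OF cartesian_forD(1)[OF m]]
  have "u \<in> U" "u' \<in> U" using step_in S by auto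
  then have "m u' u = u'" using mu R by metis
  then show ?case using nu R(2) \<open>u \<in> U\<close> by simp
next
  case (step y z)
  note C = cartesian_forD[OF m]
  note R = rect_bandD[OF C(1)]
  have S': "S y z" "m y z = z" using step by auto
  have [simp]: "u \<in> U" "u' \<in> U" "y \<in> U" "z \<in> U" using step_in S S' by auto
  have uz: "m u z = z" using R step by (metis \<open>u \<in> U\<close> \<open>y \<in> U\<close> \<open>z \<in> U\<close>)
  have 1: "S y (m u' y)" using C(4)[OF S mu, of y] step by simp
  have 2: "S z (m u' z)" using C(4)[OF S mu, of z] uz by simp
  have 3: "S (m u' y) (m u' z)" using C(3)[OF S', of u'] by simp
  have "m u' y \<noteq> z" using step_neq[OF S'(1)] S'(2) R
    by (metis \<open>u' \<in> U\<close> \<open>y \<in> U\<close>)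
  moreover have "y \<noteq> m u' z" using step_neq[OF S'(1)] S'(2) R
    by (metis \<open>u' \<in> U\<close> \<open>y \<in> U\<close> \<open>z \<in> U\<close>)
  ultimately have "n z (m u' z) = m u' z"
    using square[OF n 1 S'(1) 3 2] step by blast
  then show ?case using uz by blast
qed

text \<open>Walk from \<open>x\<close> to \<open>x'\<close> inside an \<open>n\<close>-layer. A step
  that moves the second \<open>m\<close>-coordinate is erased by replacing that coordinate with the
  one of \<open>y\<close>; a step that moves the first is slid along the \<open>m\<close>-layer and
  keeps its \<open>n\<close>-direction.\<close>

lemma same_fst_cong:
  assumes n: "cartesian_for U S n" and m: "cartesian_for U S m"
    and "x \<in> U" "x' \<in> U" "y \<in> U" "n x x' = x'"
  shows "n (m x y) (m x' y) = m x' y"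
proof -
  note Rn = rect_bandD[OF cartesian_forD(1)[OF n]]
  note Rm = rect_bandD[OF cartesian_forD(1)[OF m]]
  have "(\<lambda>u v. S u v \<and> n u v = v)\<^sup>*\<^sup>* x x'"
    using steps_in_layer[OF n \<open>x \<in> U\<close> steps[OF \<open>x \<in> U\<close> \<open>x' \<in> U\<close>]] assms Rn(2) by simp
  then show ?thesis
  proof (induction rule: rtranclp_induct)
    case base
    then show ?case using Rn Rm assms by simp
  next
    case (step u u')
    have [simp]: "u \<in> U" "u' \<in> U" using step_in step by auto
    have "n (m u y) (m u' y) = m u' y"
    proof (cases "m u u' = u'")
      case True
      then have "m u y = m u' y" using Rm \<open>y \<in> U\<close> by (metis \<open>u \<in> U\<close> \<open>u' \<in> U\<close>)
      then show ?thesis using Rn Rm \<open>y \<in> U\<close> by (metis \<open>u \<in> U\<close>)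
    next
      case False
      then have mu: "m u u' = u" using cartesian_forD(2)[OF m] step by blast
      have "(\<lambda>u v. S u v \<and> m u v = v)\<^sup>*\<^sup>* u (m u y)"
        using steps_in_layer[OF m _ steps[of u y], of u] Rm(2) \<open>y \<in> U\<close> by simp
      from translated_step[OF n m _ _ mu this] step
      show ?thesis using Rm(4)[of u' u y] \<open>y \<in> U\<close> by simp
    qed
    moreover have "n (m x y) (m u y) = m u y" using step by blast
    moreover have "m x y \<in> U" "m u y \<in> U" "m u' y \<in> U" using Rm(1) assms by auto
    ultimately show ?case using Rn(3) by metis
  qed
qed

text \<open>\<open>same_fst_cong\<close>, applied to \<open>n\<close>, \<open>m\<close> and their
  opposites, changes one argument of \<open>m\<close> at a time. So \<open>?q\<close> has the first
  \<open>n\<close>-coordinate of \<open>m x y\<close> and the second one of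
  \<open>m x' y'\<close>.\<close>

theorem cartesian_for_commute:
  assumes n: "cartesian_for U S n" and m: "cartesian_for U S m"
  shows "commuting_on U n m"
  unfolding commuting_on_def
proof (intro ballI)
  fix x x' y y' assume U: "x \<in> U" "x' \<in> U" "y \<in> U" "y' \<in> U"
  note Rn = rect_bandD[OF cartesian_forD(1)[OF n]]
  note Rm = rect_bandD[OF cartesian_forD(1)[OF m]]
  note n' = cartesian_for_opp[OF n] and m' = cartesian_for_opp[OF m]
  let ?q = "m (n x x') (n y y')"
  note [simp] = U Rn(1,2) Rm(1,2)
  have "n (m x y) (m (n x x') y) = m (n x x') y"
    by (rule same_fst_cong[OF n m]) (use Rn U in auto)
  moreover have "n (m (n x x') y) ?q = ?q"
    by (rule same_fst_cong[OF n m', of "y" "n y y'" "n x x'"]) (use Rn U in auto)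
  ultimately have 1: "n (m x y) ?q = ?q" using Rn Rm U by metis
  have "n (m (n x x') y') (m x' y') = m (n x x') y'"
    by (rule same_fst_cong[OF n' m, of x' "n x x'" y']) (use Rn U in auto)
  moreover have "n ?q (m (n x x') y') = ?q"
    by (rule same_fst_cong[OF n' m', of y' "n y y'" "n x x'"]) (use Rn U in auto)
  ultimately have 2: "n ?q (m x' y') = ?q" using Rn(3,4) Rn(1) Rm(1) U by metis
  show "?q = n (m x y) (m x' y')" using 1 2 Rn(3) Rn(1) Rm(1) U by metis
qed

end

section \<open>Strict refinement for thin relations\<close>

text \<open>The closure condition makes \<open>E\<close> the product of its two projections: if the
  first coordinates of \<open>x\<close> and \<open>w\<close> come from one related pair and the
  second coordinates from another, then \<open>x\<close> and \<open>w\<close> are related.\<close>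

definition decomposition_op ::
    "'u set \<Rightarrow> 'w set \<Rightarrow> ('u \<Rightarrow> 'w \<Rightarrow> bool) \<Rightarrow> ('u \<Rightarrow> 'u \<Rightarrow> 'u) \<Rightarrow> ('w \<Rightarrow> 'w \<Rightarrow> 'w) \<Rightarrow> bool" where
  "decomposition_op U W E n n' \<longleftrightarrow> rect_band U n \<and> rect_band W n' \<and>
     (\<forall>x1\<in>U. \<forall>x2\<in>U. \<forall>w1\<in>W. \<forall>w2\<in>W. E x1 w1 \<longrightarrow> E x2 w2 \<longrightarrow> E (n x1 x2) (n' w1 w2))"

lemma decomposition_opD:
  assumes "decomposition_op U W E n n'"
  shows "rect_band U n" "rect_band W n'"
    and "x1 \<in> U \<Longrightarrow> x2 \<in> U \<Longrightarrow> w1 \<in> W \<Longrightarrow> w2 \<in> W \<Longrightarrow> E x1 w1 \<Longrightarrow> E x2 w2 \<Longrightarrow> E (n x1 x2) (n' w1 w2)"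
  using assms unfolding decomposition_op_def by blast+

lemma decomposition_op_opp:
  "decomposition_op U W E n n' \<Longrightarrow> decomposition_op U W E (\<lambda>x y. n y x) (\<lambda>x y. n' y x)"
  unfolding decomposition_op_def by (auto intro: rect_band_opp)

lemma decomposition_op_transpose:
  "decomposition_op U W E n n' \<Longrightarrow> decomposition_op W U (\<lambda>w u. E u w) n' n"
  unfolding decomposition_op_def by blast

definition row :: "'w set \<Rightarrow> ('u \<Rightarrow> 'w \<Rightarrow> bool) \<Rightarrow> 'u \<Rightarrow> 'w set" where
  "row W E x = {w \<in> W. E x w}"

section \<open>The Cartesian skeleton of one side of a relation\<close>

locale thin_birelation =
  fixes U :: "'u set" and W :: "'w set" and E :: "'u \<Rightarrow> 'w \<Rightarrow> bool"
  assumes finite_cols: "finite W"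
    and thin: "x \<in> U \<Longrightarrow> y \<in> U \<Longrightarrow> row W E x = row W E y \<Longrightarrow> x = y"
    and row_nonempty: "x \<in> U \<Longrightarrow> row W E x \<noteq> {}"
    and linked: "x \<in> U \<Longrightarrow> y \<in> U \<Longrightarrow>
      (\<lambda>u v. u \<in> U \<and> v \<in> U \<and> row W E u \<inter> row W E v \<noteq> {})\<^sup>*\<^sup>* x y"
begin

abbreviation N :: "'u \<Rightarrow> 'w set" where "N \<equiv> row W E"

text \<open>One of the two mirror-image conditions for a pair to be dispensable. The second disjunct
  covers \<open>N x \<subset> N y\<close>: there \<open>N x \<inter> N y\<close> is already all of
  \<open>N x\<close>, and the first disjunct cannot hold.\<close>

definition closer :: "'u \<Rightarrow> 'u \<Rightarrow> 'u \<Rightarrow> bool" where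
  "closer x y z \<longleftrightarrow> N x \<inter> N y \<subset> N x \<inter> N z \<or> N x \<subset> N z \<and> N z \<subset> N y"

text \<open>The edges of the Cartesian skeleton of Hammack and Imrich, on one side of the relation.\<close>

definition skeleton :: "'u \<Rightarrow> 'u \<Rightarrow> bool" where
  "skeleton x y \<longleftrightarrow> x \<in> U \<and> y \<in> U \<and> x \<noteq> y \<and> N x \<inter> N y \<noteq> {} \<and>
     \<not> (\<exists>z\<in>U. closer x y z \<and> closer y x z)"

lemma skeleton_sym: "skeleton x y \<Longrightarrow> skeleton y x"
  unfolding skeleton_def by blast

lemma finite_N: "finite (N x)"
  using finite_cols unfolding row_def by auto

lemma N_subset: "N x \<subseteq> W" unfolding row_def by auto

text \<open>A dispensable pair is replaced by the detour through its witness \<open>z\<close>. Each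
  half of the detour has more common neighbours than the pair, or equally many and a smaller sum of
  degrees; this is the lexicographic measure.\<close>

lemma skeleton_path_linked:
  assumes "x \<in> U" "y \<in> U" "N x \<inter> N y \<noteq> {}"
  shows "skeleton\<^sup>*\<^sup>* x y"
  using assms
proof (induction "(card W - card (N x \<inter> N y), card (N x) + card (N y))" arbitrary: x y
    rule: wf_induct_rule[OF wf_lex_prod[OF wf_less_than wf_less_than]])
  case (1 x y)
  note IH = 1(1) and xy = 1(2-)
  show ?case
  proof (cases "x = y \<or> skeleton x y")
    case False
    then obtain z where z: "z \<in> U" "closer x y z" "closer y x z"
      using xy unfolding skeleton_def by blast
    have measure: "((card W - card (N x' \<inter> N z), card (N x') + card (N z)),
          (card W - card (N x \<inter> N y), card (N x) + card (N y))) \<in> less_than <*lex*> less_than"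
        "N x' \<inter> N z \<noteq> {}"
      if "closer x' y' z" "x' = x \<and> y' = y \<or> x' = y \<and> y' = x" for x' y'
    proof -
      have card_le: "card (N x' \<inter> N z) \<le> card W"
        using N_subset finite_cols by (meson card_mono inf.coboundedI1)
      have int: "N x \<inter> N y = N x' \<inter> N y'" using that by blast
      have sum: "card (N x) + card (N y) = card (N x') + card (N y')" using that by auto
      have "((card W - card (N x' \<inter> N z), card (N x') + card (N z)),
          (card W - card (N x' \<inter> N y'), card (N x') + card (N y'))) \<in> less_than <*lex*> less_than
          \<and> N x' \<inter> N z \<noteq> {}"
        using that(1) unfolding closer_def
      proof
        assume "N x' \<inter> N y' \<subset> N x' \<inter> N z"
        moreover from this have "card (N x' \<inter> N y') < card (N x' \<inter> N z)"
          by (simp add: finite_N psubset_card_mono)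
        ultimately show ?thesis using card_le by (auto intro: diff_less_mono2)
      next
        assume A: "N x' \<subset> N z \<and> N z \<subset> N y'"
        then have "N x' \<inter> N z = N x' \<inter> N y'" by blast
        moreover have "card (N z) < card (N y')" using A by (simp add: finite_N psubset_card_mono)
        ultimately show ?thesis using int xy(3) that(2) by auto
      qed
      then show "((card W - card (N x' \<inter> N z), card (N x') + card (N z)),
          (card W - card (N x \<inter> N y), card (N x) + card (N y))) \<in> less_than <*lex*> less_than"
        "N x' \<inter> N z \<noteq> {}" using int sum by simp_all
    qed
    have "skeleton\<^sup>*\<^sup>* x z" by (rule IH) (use z xy measure[of x y] in blast)+
    moreover have "skeleton\<^sup>*\<^sup>* y z" by (rule IH) (use z xy measure[of y x] in blast)+
    then have "skeleton\<^sup>*\<^sup>* z y"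
      by (rule sympD[OF symp_rtranclp[OF sympI[OF skeleton_sym]], rotated])
    ultimately show ?thesis by simp
  qed auto
qed

lemma skeleton_path:
  assumes "x \<in> U" "y \<in> U" shows "skeleton\<^sup>*\<^sup>* x y"
  using linked[OF assms]
  by (induction rule: rtranclp_induct) (auto intro: rtranclp_trans skeleton_path_linked)

sublocale connected_steps U skeleton
  by unfold_locales (auto simp: skeleton_def skeleton_path)

section \<open>Neighbourhoods under a decomposition\<close>

context
  fixes n n'
  assumes dec: "decomposition_op U W E n n'"
begin

private lemmas Rn = rect_bandD[OF decomposition_opD(1)[OF dec]]
private lemmas Rn' = rect_bandD[OF decomposition_opD(2)[OF dec]]

lemma N_op: "x \<in> U \<Longrightarrow> y \<in> U \<Longrightarrow> w1 \<in> N x \<Longrightarrow> w2 \<in> N y \<Longrightarrow> n' w1 w2 \<in> N (n x y)"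
  using decomposition_opD(3)[OF dec] Rn'(1) unfolding row_def by blast

text \<open>Give \<open>w\<close> the second coordinate of some \<open>r\<close> in
  \<open>N x\<close>. The result lies in \<open>N x\<close>, hence in \<open>N y\<close>, and
  restoring the second coordinate of \<open>w\<close> leads to \<open>N (n y s)\<close>.\<close>

lemma N_op_mono_left:
  assumes "x \<in> U" "y \<in> U" "s \<in> U" "N x \<subseteq> N y"
  shows "N (n x s) \<subseteq> N (n y s)"
proof
  fix w assume w: "w \<in> N (n x s)"
  obtain r where r: "r \<in> N x" using row_nonempty assms by blast
  have "n' w r \<in> N (n (n x s) x)" by (rule N_op) (use assms w r Rn in auto)
  then have "n' w r \<in> N y" using assms Rn by auto
  then have "n' (n' w r) w \<in> N (n y (n x s))" by (intro N_op) (use assms w Rn in auto)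
  moreover have "w \<in> W" "r \<in> W" using w r N_subset by blast+
  ultimately show "w \<in> N (n y s)" using assms Rn Rn' by auto
qed

text \<open>Used in contrapositive form: a neighbour of the corner \<open>n x y\<close> outside
  \<open>N y\<close> can be moved into \<open>N x\<close> while staying outside \<open>N y\<close>,
  so the corner shares more with \<open>x\<close> than \<open>y\<close> does.\<close>

lemma op_subset_snd:
  assumes "x \<in> U" "y \<in> U" "u \<in> N x" "u \<in> N y" "N x \<inter> N (n x y) \<subseteq> N y"
  shows "N (n x y) \<subseteq> N y"
proof
  fix w assume w: "w \<in> N (n x y)"
  let ?z = "n x y"
  have z: "?z \<in> U" using assms Rn by auto
  have W: "w \<in> W" "u \<in> W" using w assms N_subset by blast+
  have "n' u u \<in> N ?z" using N_op assms by blast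
  then have uz: "u \<in> N ?z" using Rn' W by auto
  have "n' w u \<in> N (n ?z x)" "n' w u \<in> N (n ?z ?z)"
    by (rule N_op; use assms w uz z in blast)+
  then have "n' w u \<in> N y" using assms Rn z by auto
  then have "n' (n' w u) w \<in> N (n y ?z)" by (intro N_op) (use assms w z in auto)
  then show "w \<in> N y" using assms Rn Rn' W by auto
qed

end

lemma N_op_mono_right:
  assumes "decomposition_op U W E n n'" "x \<in> U" "y \<in> U" "s \<in> U" "N x \<subseteq> N y"
  shows "N (n s x) \<subseteq> N (n s y)"
  using N_op_mono_left[OF decomposition_op_opp[OF assms(1)] assms(2-)] .

lemma op_subset_fst:
  assumes "decomposition_op U W E n n'" 
    and "x \<in> U" "y \<in> U" "u \<in> N x" "u \<in> N y" "N y \<inter> N (n x y) \<subseteq> N x"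
  shows "N (n x y) \<subseteq> N x"
  using op_subset_snd[OF decomposition_op_opp[OF assms(1)], of y x u] assms by blast

lemma op_closer:
  assumes dec: "decomposition_op U W E n n'" and U: "x \<in> U" "y \<in> U"
    and u: "u \<in> N x" "u \<in> N y" and "\<not> N (n x y) \<subseteq> N x" "\<not> N (n x y) \<subseteq> N y"
  shows "closer x y (n x y) \<and> closer y x (n x y)"
proof -
  note Rn' = rect_bandD[OF decomposition_opD(2)[OF dec]]
  have "N x \<inter> N y \<subseteq> N (n x y)"
  proof
    fix w assume w: "w \<in> N x \<inter> N y"
    then have "n' w w \<in> N (n x y)" using N_op[OF dec U] by blast
    then show "w \<in> N (n x y)" using Rn'(2)[of w] w N_subset[of x] by auto
  qed
  then show ?thesis unfolding closer_def
    using op_subset_fst[OF dec U u] op_subset_snd[OF dec U u] assms by blast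
qed

text \<open>\<open>?z\<close> and \<open>?z'\<close> are the other corners of the rectangle spanned
  by \<open>x\<close> and \<open>y\<close>. Neither makes the pair dispensable, so each has its
  neighbourhood inside \<open>N x\<close> or \<open>N y\<close>, and monotonicity turns the bound on
  \<open>?z'\<close> into a reverse bound on \<open>?z\<close>. Then \<open>N ?z\<close> equals
  \<open>N x\<close> or \<open>N y\<close>, against thinness, or lies strictly between them, which
  makes the pair dispensable after all.\<close>

lemma skeleton_one_coordinate:
  assumes dec: "decomposition_op U W E n n'" and S: "skeleton x y"
  shows "n x y = y \<or> n x y = x"
proof (rule ccontr)
  assume neq: "\<not> (n x y = y \<or> n x y = x)"
  have U: "x \<in> U" "y \<in> U" using S unfolding skeleton_def by auto
  note Rn = rect_bandD[OF decomposition_opD(1)[OF dec]]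
  let ?z = "n x y" and ?z' = "n y x"
  have z: "?z \<in> U" "?z' \<in> U" using U Rn by auto
  have nc: "\<not> (closer x y ?z \<and> closer y x ?z)" "\<not> (closer x y ?z' \<and> closer y x ?z')"
    using S z unfolding skeleton_def by blast+
  obtain u where u: "u \<in> N x" "u \<in> N y" using S unfolding skeleton_def by blast
  have dich: "N ?z \<subseteq> N x \<or> N ?z \<subseteq> N y" "N ?z' \<subseteq> N x \<or> N ?z' \<subseteq> N y"
    using op_closer[OF dec U u] op_closer[OF dec U(2,1) u(2,1)] nc by blast+
  \<comment> \<open>These are the monotonicity lemmas with \<open>n ?z' y = y\<close> and
    \<open>n x ?z' = x\<close>.\<close>
  have zz: "N ?z' \<subseteq> N x \<Longrightarrow> N y \<subseteq> N ?z" "N ?z' \<subseteq> N y \<Longrightarrow> N x \<subseteq> N ?z"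
    using N_op_mono_left[OF dec z(2) U(1) U(2)] N_op_mono_right[OF dec z(2) U(2) U(1)]
    Rn U by auto
  have ne: "N ?z \<noteq> N x" "N ?z \<noteq> N y" using thin z U neq by blast+
  have int: "N x \<subset> N ?z \<Longrightarrow> N ?z \<subset> N y \<Longrightarrow> closer x y ?z \<and> closer y x ?z"
    "N y \<subset> N ?z \<Longrightarrow> N ?z \<subset> N x \<Longrightarrow> closer x y ?z \<and> closer y x ?z"
    unfolding closer_def by blast+
  show False using dich zz ne int nc by blast
qed

text \<open>Brings a witness of dispensability found in the layer of \<open>t\<close> back to the
  layer of \<open>x\<close>, by exchanging the first coordinate of the witness and of all neighbours
  involved.\<close>

lemma closer_untranslate:
  assumes dec: "decomposition_op U W E n n'"
    and U: "x \<in> U" "y \<in> U" "t \<in> U" "z \<in> U" and n: "n x y = y"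
    and c: "closer (n t x) (n t y) z"
  shows "closer x y (n x z)"
proof -
  note Rn = rect_bandD[OF decomposition_opD(1)[OF dec]]
  note Rn' = rect_bandD[OF decomposition_opD(2)[OF dec]]
  let ?x = "n t x" and ?y = "n t y"
  have U': "?x \<in> U" "?y \<in> U" "n x z \<in> U" using U Rn by auto
  from c show ?thesis unfolding closer_def
  proof
    assume A: "N ?x \<inter> N ?y \<subset> N ?x \<inter> N z"
    obtain r where r: "r \<in> N t" using row_nonempty U by blast
    have "N x \<inter> N y \<subseteq> N x \<inter> N (n x z)"
    proof
      fix w assume w: "w \<in> N x \<inter> N y"
      then have "n' r w \<in> N ?x" "n' r w \<in> N ?y" using N_op[OF dec] U r by blast+
      then have "n' r w \<in> N z" using A by blast
      then have "n' w (n' r w) \<in> N (n x z)" using N_op[OF dec] U w by blast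
      moreover have "w \<in> W" "r \<in> W" using w r N_subset by blast+
      ultimately show "w \<in> N x \<inter> N (n x z)" using Rn' w by auto
    qed
    moreover
    obtain w where w: "w \<in> N ?x" "w \<in> N z" "w \<notin> N ?y" using A by blast
    obtain u where u: "u \<in> N x" using row_nonempty U by blast
    have W: "w \<in> W" "u \<in> W" using w u N_subset by blast+
    have "n' u w \<in> N (n x ?x)" "n' u w \<in> N (n x z)" using N_op[OF dec] U U' u w by blast+
    then have "n' u w \<in> N x \<inter> N (n x z)" using Rn U by auto
    moreover have "n' u w \<notin> N y"
    proof
      assume "n' u w \<in> N y"
      then have "n' w (n' u w) \<in> N (n ?x y)" using N_op[OF dec] U U' w by blast
      then show False using w Rn Rn' W U by auto
    qed
    ultimately show "N x \<inter> N y \<subset> N x \<inter> N (n x z) \<or> N x \<subset> N (n x z) \<and> N (n x z) \<subset> N y"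
      by blast
  next
    assume A: "N ?x \<subset> N z \<and> N z \<subset> N ?y"
    have 1: "N x \<subseteq> N (n x z)" 
      using N_op_mono_right[OF dec U'(1) U(4) U(1)] A U Rn by auto
    have 2: "N (n x z) \<subseteq> N y"
      using N_op_mono_right[OF dec U(4) U'(2) U(1)] A U Rn n by auto
    \<comment> \<open>Both outer terms reduce to \<open>n t z\<close>, so \<open>N z\<close> is
      squeezed and thinness puts \<open>z\<close> into the layer of \<open>t\<close>. Moving it to
      the layer of \<open>x\<close> is then reversible, and the inclusions stay strict.\<close>
    have "N (n ?x z) \<subseteq> N (n z z)" "N (n z z) \<subseteq> N (n ?y z)"
      using N_op_mono_left[OF dec] A U U' by (meson psubset_imp_subset)+
    moreover have "n ?x z = n t z" "n ?y z = n t z" using Rn U by auto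
    ultimately have "N (n t z) = N z" using Rn(2) U by auto
    then have tz: "n t z = z" using thin Rn U by auto
    have "n x z \<noteq> x"
    proof
      assume "n x z = x"
      then have "n t (n x z) = n t x" by simp
      then show False using tz A Rn U by auto
    qed
    moreover have "n x z \<noteq> y"
    proof
      assume "n x z = y"
      then have "n t (n x z) = n t y" by simp
      then show False using tz A Rn U by auto
    qed
    ultimately have "N (n x z) \<noteq> N x" "N (n x z) \<noteq> N y" using thin U U' by blast+
    then show "N x \<inter> N y \<subset> N x \<inter> N (n x z) \<or> N x \<subset> N (n x z) \<and> N (n x z) \<subset> N y"
      using 1 2 by blast
  qed
qed

lemma skeleton_translate:
  assumes dec: "decomposition_op U W E n n'" and S: "skeleton x y"
    and n: "n x y = y" and t: "t \<in> U"
  shows "skeleton (n t x) (n t y)"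
proof -
  note Rn = rect_bandD[OF decomposition_opD(1)[OF dec]]
  have U: "x \<in> U" "y \<in> U" and "x \<noteq> y" using S unfolding skeleton_def by auto
  have yx: "n y x = x" using n Rn(2,3) U by metis
  have ne: "n t x \<noteq> n t y"
  proof
    assume "n t x = n t y"
    then have "n x (n t x) = n x (n t y)" by simp
    then show False using n U t Rn \<open>x \<noteq> y\<close> by auto
  qed
  obtain u where u: "u \<in> N x" "u \<in> N y" using S unfolding skeleton_def by blast
  obtain r where r: "r \<in> N t" using row_nonempty t by blast
  have "n' r u \<in> N (n t x) \<inter> N (n t y)" using N_op[OF dec] U t u r by blast
  moreover have False if z: "z \<in> U" "closer (n t x) (n t y) z" "closer (n t y) (n t x) z" for z
  proof -
    \<comment> \<open>\<open>x\<close> and \<open>y\<close> have the same first coordinate, so one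
      translated witness serves both halves of dispensability.\<close>
    have "n y z = n x z" using n Rn(3)[of x y z] U z by metis
    then have "closer x y (n x z)" "closer y x (n x z)"
      using closer_untranslate[OF dec U t z(1) n z(2)] closer_untranslate[OF dec U(2,1) t z(1) yx z(3)]
      by simp_all
    then show False using S Rn(1)[OF U(1) z(1)] unfolding skeleton_def by blast
  qed
  ultimately show ?thesis using ne Rn U t unfolding skeleton_def by blast
qed

lemma cartesian_for_skeleton:
  assumes dec: "decomposition_op U W E n n'"
  shows "cartesian_for U skeleton n"
  unfolding cartesian_for_def
proof (intro conjI allI ballI impI)
  show "rect_band U n" by (rule decomposition_opD(1)[OF dec])
  show "n x y = y \<or> n x y = x" if "skeleton x y" for x y
    using skeleton_one_coordinate[OF dec that] .
  show "skeleton (n t x) (n t y)" if "t \<in> U" "skeleton x y \<and> n x y = y" for x y t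
    using skeleton_translate[OF dec] that by blast
  show "skeleton (n x t) (n y t)" if "t \<in> U" "skeleton x y \<and> n x y = x" for x y t
    using skeleton_translate[OF decomposition_op_opp[OF dec], of y x t] that skeleton_sym by blast
qed

text \<open>The skeleton is defined from \<open>E\<close> alone. Hence all decompositions of
  \<open>E\<close> are Cartesian for the same steps, and any two of them commute.\<close>

theorem strict_refinement:
  assumes "decomposition_op U W E n n'" "decomposition_op U W E m m'"
  shows "commuting_on U n m"
  by (rule cartesian_for_commute; rule cartesian_for_skeleton; fact)

end

section \<open>Isomorphisms and prime factorizations\<close>

text \<open>Arcs are pairs of vertices, so the arc map inside \<open>digraph_iso\<close> is
  determined by the vertex map, which is all that is kept here.\<close>

definition graph_iso_map :: "'a pair_pre_digraph \<Rightarrow> 'b pair_pre_digraph \<Rightarrow> ('a \<Rightarrow> 'b) \<Rightarrow> bool" where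
  "graph_iso_map G H f \<longleftrightarrow> bij_betw f (pverts G) (pverts H) \<and>
     (\<forall>u\<in>pverts G. \<forall>v\<in>pverts G. (f u, f v) \<in> parcs H \<longleftrightarrow> (u, v) \<in> parcs G)"

lemma digraph_iso_iff_graph_iso_map:
  assumes "pair_wf_digraph G" "pair_wf_digraph H"
  shows "digraph_iso (with_proj G) (with_proj H) \<longleftrightarrow> (\<exists>f. graph_iso_map G H f)"
proof
  assume "digraph_iso (with_proj G) (with_proj H)"
  then obtain h where iso: "pre_digraph.digraph_isomorphism (with_proj G) h"
    and H: "with_proj H = app_iso h (with_proj G)" unfolding digraph_iso_def by blast
  let ?f = "iso_verts h"
  have hd: "iso_tail h = fst" "iso_head h = snd" "pverts H = ?f ` pverts G"
    "parcs H = iso_arcs h ` parcs G"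
    using arg_cong[OF H, of tail] arg_cong[OF H, of head] arg_cong[OF H, of verts]
      arg_cong[OF H, of arcs] by simp_all
  have inj: "inj_on ?f (pverts G)" using iso unfolding pre_digraph.digraph_isomorphism_def by simp
  have arc: "iso_arcs h (u, v) = (?f u, ?f v)" if "(u, v) \<in> parcs G" for u v
    using iso that hd unfolding pre_digraph.digraph_isomorphism_def
    by (metis (no_types, lifting) fst_conv prod.collapse snd_conv with_proj_simps(2,4,5))
  have "(?f u, ?f v) \<in> parcs H \<longleftrightarrow> (u, v) \<in> parcs G"
    if uv: "u \<in> pverts G" "v \<in> pverts G" for u v
  proof
    assume "(?f u, ?f v) \<in> parcs H"
    then obtain x y where xy: "(x, y) \<in> parcs G" "(?f u, ?f v) = (?f x, ?f y)"
      using arc hd by auto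
    then have "x \<in> pverts G" "y \<in> pverts G"
      using pair_wf_digraph.wellformed'[OF assms(1)] by blast+
    then show "(u, v) \<in> parcs G" using xy uv inj by (auto dest: inj_onD)
  next
    assume "(u, v) \<in> parcs G"
    then show "(?f u, ?f v) \<in> parcs H" using arc hd by force
  qed
  then show "\<exists>f. graph_iso_map G H f"
    using inj hd unfolding graph_iso_map_def bij_betw_def by blast
next
  assume "\<exists>f. graph_iso_map G H f"
  then obtain f where bij: "bij_betw f (pverts G) (pverts H)"
    and f: "\<And>u v. u \<in> pverts G \<Longrightarrow> v \<in> pverts G \<Longrightarrow> (f u, f v) \<in> parcs H \<longleftrightarrow> (u, v) \<in> parcs G"
    unfolding graph_iso_map_def by blast
  note wf = pair_wf_digraph.wellformed'[OF assms(1)] pair_wf_digraph.wellformed'[OF assms(2)]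
  let ?h = "\<lparr> iso_verts = f, iso_arcs = map_prod f f, iso_head = snd, iso_tail = fst \<rparr>"
  have arcs: "map_prod f f ` parcs G = parcs H"
  proof (intro equalityI subsetI)
    fix e assume "e \<in> map_prod f f ` parcs G"
    then show "e \<in> parcs H" using f wf by auto
  next
    fix e assume e: "e \<in> parcs H"
    obtain a b where ab: "e = (a, b)" by (cases e)
    then have "a \<in> f ` pverts G" "b \<in> f ` pverts G"
      using e wf bij unfolding bij_betw_def by blast+
    then obtain u v where "u \<in> pverts G" "v \<in> pverts G" "a = f u" "b = f v" by blast
    then show "e \<in> map_prod f f ` parcs G" using f e ab by force
  qed
  have inj: "inj_on f (pverts G)" using bij unfolding bij_betw_def by blast
  have "inj_on (map_prod f f) (parcs G)"
  proof (rule inj_onI)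
    fix a b assume "a \<in> parcs G" "b \<in> parcs G" "map_prod f f a = map_prod f f b"
    then show "a = b" using inj wf by (cases a; cases b) (auto dest: inj_onD)
  qed
  then have "pre_digraph.digraph_isomorphism (with_proj G) ?h"
    using inj wf_digraph_wp_iff assms unfolding pre_digraph.digraph_isomorphism_def by auto
  moreover have "with_proj H = app_iso ?h (with_proj G)"
    using arcs bij unfolding app_iso_def with_proj_def bij_betw_def by simp
  ultimately show "digraph_iso (with_proj G) (with_proj H)" unfolding digraph_iso_def by blast
qed

lemma pseudo_graph_iff:
  "pair_pseudo_graph G \<longleftrightarrow> finite (pverts G) \<and> parcs G \<subseteq> pverts G \<times> pverts G \<and> sym (parcs G)"
proof
  assume "pair_pseudo_graph G"
  then interpret pair_pseudo_graph G .
  show "finite (pverts G) \<and> parcs G \<subseteq> pverts G \<times> pverts G \<and> sym (parcs G)"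
    using pair_finite_verts wellformed' arcs_symmetric by (auto intro: symI)
next
  assume A: "finite (pverts G) \<and> parcs G \<subseteq> pverts G \<times> pverts G \<and> sym (parcs G)"
  then have "finite (parcs G)" by (meson finite_SigmaI finite_subset)
  then show "pair_pseudo_graph G"
    using A by unfold_locales (auto simp: symmetric_def)
qed

lemma pseudo_graph_wf: "pair_pseudo_graph G \<Longrightarrow> pair_wf_digraph G"
  by (simp add: pair_pseudo_graph.axioms(2) pair_sym_digraph.axioms(1))

lemma pverts_direct_product: "pverts (G \<times>\<^sub>g H) = pverts G \<times> pverts H"
  and parcs_direct_product: "((u, v), (x, y)) \<in> parcs (G \<times>\<^sub>g H) \<longleftrightarrow> (u, x) \<in> parcs G \<and> (v, y) \<in> parcs H"
  unfolding direct_product_def by auto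

lemma pseudo_graph_direct_product:
  assumes "pair_pseudo_graph G" "pair_pseudo_graph H" shows "pair_pseudo_graph (G \<times>\<^sub>g H)"
  using assms unfolding pseudo_graph_iff direct_product_def sym_def by auto

text \<open>Factors are realized as images under a projection. Arcs are images of arcs, not induced
  ones: a projection can turn an arc into a loop, which is how factors with loops arise.\<close>

definition image_graph :: "('a \<Rightarrow> 'b) \<Rightarrow> 'a pair_pre_digraph \<Rightarrow> 'b pair_pre_digraph" where
  "image_graph f G = \<lparr> pverts = f ` pverts G, parcs = map_prod f f ` parcs G \<rparr>"

lemma image_graph_simps:
  "pverts (image_graph f G) = f ` pverts G" "parcs (image_graph f G) = map_prod f f ` parcs G"
  unfolding image_graph_def by auto

lemma pseudo_graph_image_graph:
  "pair_pseudo_graph G \<Longrightarrow> pair_pseudo_graph (image_graph f G)"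
  unfolding pseudo_graph_iff image_graph_def sym_def by force

lemma graph_iso_map_comp:
  "graph_iso_map G H f \<Longrightarrow> graph_iso_map H K g \<Longrightarrow> graph_iso_map G K (g \<circ> f)"
  unfolding graph_iso_map_def by (auto intro: bij_betw_trans dest: bij_betwE)

lemma graph_iso_map_product:
  assumes "graph_iso_map G H f" "graph_iso_map G' H' g"
  shows "graph_iso_map (G \<times>\<^sub>g G') (H \<times>\<^sub>g H') (map_prod f g)"
  using assms unfolding graph_iso_map_def pverts_direct_product
  by (auto simp: parcs_direct_product intro: bij_betw_map_prod)

text \<open>\<open>graph_coprime\<close> and \<open>direct_prime\<close> quantify over graphs on
  natural numbers, so factors obtained as images have to be relabelled.\<close>

lemma nat_copy:
  assumes "pair_pseudo_graph G"
  obtains H :: "nat pair_pre_digraph" and f where "pair_pseudo_graph H" "graph_iso_map G H f"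
proof -
  obtain f :: "'a \<Rightarrow> nat" where inj: "inj_on f (pverts G)"
    using assms finite_imp_inj_to_nat_seg[of "pverts G"] unfolding pseudo_graph_iff by blast
  have "graph_iso_map G (image_graph f G) f"
    unfolding graph_iso_map_def image_graph_simps
  proof (intro conjI ballI)
    show "bij_betw f (pverts G) (f ` pverts G)" using inj by (rule inj_on_imp_bij_betw)
    fix u v assume uv: "u \<in> pverts G" "v \<in> pverts G"
    show "(f u, f v) \<in> map_prod f f ` parcs G \<longleftrightarrow> (u, v) \<in> parcs G"
    proof
      assume "(f u, f v) \<in> map_prod f f ` parcs G"
      then obtain a b where ab: "(a, b) \<in> parcs G" "f u = f a" "f v = f b" by auto
      moreover from ab(1) have "a \<in> pverts G" "b \<in> pverts G"
        using assms unfolding pseudo_graph_iff by auto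
      ultimately show "(u, v) \<in> parcs G" using inj uv by (metis inj_onD)
    qed (simp add: rev_image_eqI)
  qed
  then show ?thesis using that pseudo_graph_image_graph assms by blast
qed

lemma card_direct_product: "card (pverts (G \<times>\<^sub>g H)) = card (pverts G) * card (pverts H)"
  unfolding pverts_direct_product by (rule card_cartesian_product)

section \<open>Products of lists and existence of prime factorizations\<close>

lemma direct_product_list_simps:
  "pverts (direct_product_list Gs) = {us. list_all2 (\<lambda>u G. u \<in> pverts G) us Gs}"
  "(us, vs) \<in> parcs (direct_product_list Gs) \<longleftrightarrow> length us = length Gs \<and> length vs = length Gs \<and>
      (\<forall>i < length Gs. (us ! i, vs ! i) \<in> parcs (Gs ! i))"
  unfolding direct_product_list_def by auto

lemma wf_direct_product_list:
  assumes "\<forall>G\<in>set Gs. pair_wf_digraph G" shows "pair_wf_digraph (direct_product_list Gs)"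
proof
  fix e assume "e \<in> parcs (direct_product_list Gs)"
  moreover obtain us vs where "e = (us, vs)" by (cases e)
  ultimately have *: "length us = length Gs" "length vs = length Gs"
    "\<And>i. i < length Gs \<Longrightarrow> (us ! i, vs ! i) \<in> parcs (Gs ! i)" "e = (us, vs)"
    by (auto simp: direct_product_list_simps)
  then have "\<And>i. i < length Gs \<Longrightarrow> us ! i \<in> pverts (Gs ! i) \<and> vs ! i \<in> pverts (Gs ! i)"
    using assms pair_wf_digraph.wellformed' by (metis nth_mem)
  then show "fst e \<in> pverts (direct_product_list Gs)" "snd e \<in> pverts (direct_product_list Gs)"
    using * by (auto simp: direct_product_list_simps list_all2_conv_all_nth)
qed

lemma graph_iso_map_append:
  "graph_iso_map (direct_product_list Gs \<times>\<^sub>g direct_product_list Hs) (direct_product_list (Gs @ Hs))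
     (\<lambda>(us, vs). us @ vs)"
  unfolding graph_iso_map_def pverts_direct_product direct_product_list_simps(1)
proof (intro conjI ballI)
  show "bij_betw (\<lambda>(us, vs). us @ vs)
     ({us. list_all2 (\<lambda>u G. u \<in> pverts G) us Gs} \<times> {us. list_all2 (\<lambda>u G. u \<in> pverts G) us Hs})
     {us. list_all2 (\<lambda>u G. u \<in> pverts G) us (Gs @ Hs)}"
    unfolding bij_betw_def
  proof (intro conjI equalityI subsetI)
    fix ws assume "ws \<in> {us. list_all2 (\<lambda>u G. u \<in> pverts G) us (Gs @ Hs)}"
    then obtain us vs where "ws = us @ vs" "list_all2 (\<lambda>u G. u \<in> pverts G) us Gs"
      "list_all2 (\<lambda>u G. u \<in> pverts G) vs Hs" by (auto simp: list_all2_append2)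
    then show "ws \<in> (\<lambda>(us, vs). us @ vs) ` ({us. list_all2 (\<lambda>u G. u \<in> pverts G) us Gs} \<times>
        {us. list_all2 (\<lambda>u G. u \<in> pverts G) us Hs})" by force
  next
    show "inj_on (\<lambda>(us, vs). us @ vs)
     ({us. list_all2 (\<lambda>u G. u \<in> pverts G) us Gs} \<times> {us. list_all2 (\<lambda>u G. u \<in> pverts G) us Hs})"
    proof (rule inj_onI, clarify)
      fix us vs xs ys
      assume "list_all2 (\<lambda>u G. u \<in> pverts G) us Gs" "list_all2 (\<lambda>u G. u \<in> pverts G) xs Gs"
        and eq: "us @ vs = xs @ ys"
      then have "length us = length xs" using list_all2_lengthD by metis
      then show "us = xs \<and> vs = ys" using eq by simp
    qed
  qed (auto simp: list_all2_appendI)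
next
  fix p q
  assume p: "p \<in> {us. list_all2 (\<lambda>u G. u \<in> pverts G) us Gs} \<times> {us. list_all2 (\<lambda>u G. u \<in> pverts G) us Hs}"
    and q: "q \<in> {us. list_all2 (\<lambda>u G. u \<in> pverts G) us Gs} \<times> {us. list_all2 (\<lambda>u G. u \<in> pverts G) us Hs}"
  obtain us vs xs ys where pq: "p = (us, vs)" "q = (xs, ys)" by (cases p; cases q)
  have len: "length us = length Gs" "length vs = length Hs" "length xs = length Gs" "length ys = length Hs"
    using p q pq list_all2_lengthD by auto
  have "(\<forall>i < length (Gs @ Hs). ((us @ vs) ! i, (xs @ ys) ! i) \<in> parcs ((Gs @ Hs) ! i)) \<longleftrightarrow>
    (\<forall>i < length Gs. (us ! i, xs ! i) \<in> parcs (Gs ! i)) \<and>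
    (\<forall>i < length Hs. (vs ! i, ys ! i) \<in> parcs (Hs ! i))" (is "?L \<longleftrightarrow> ?R")
  proof
    assume L: ?L
    show ?R
    proof (intro conjI allI impI)
      fix i assume "i < length Gs"
      then show "(us ! i, xs ! i) \<in> parcs (Gs ! i)"
        using L[rule_format, of i] len by (simp add: nth_append)
    next
      fix i assume "i < length Hs"
      then show "(vs ! i, ys ! i) \<in> parcs (Hs ! i)"
        using L[rule_format, of "length Gs + i"] len by (simp add: nth_append)
    qed
  next
    assume ?R then show ?L using len by (auto simp: nth_append)
  qed
  then show "(case p of (us, vs) \<Rightarrow> us @ vs, case q of (us, vs) \<Rightarrow> us @ vs)
      \<in> parcs (direct_product_list (Gs @ Hs)) \<longleftrightarrow>
    (p, q) \<in> parcs (direct_product_list Gs \<times>\<^sub>g direct_product_list Hs)"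
    using len pq by (simp add: parcs_direct_product direct_product_list_simps)
qed

lemma prime_factorization_wf:
  "prime_factorization_of Gs G \<Longrightarrow> pair_wf_digraph (direct_product_list Gs)"
  unfolding prime_factorization_of_def direct_prime_def
  by (auto intro: wf_direct_product_list pseudo_graph_wf)

lemma prime_factorization_append:
  assumes "pair_pseudo_graph G" "pair_pseudo_graph A" "pair_pseudo_graph B"
    and "graph_iso_map G (A \<times>\<^sub>g B) f"
    and "prime_factorization_of Gs A" "prime_factorization_of Hs B"
  shows "prime_factorization_of (Gs @ Hs) G"
proof -
  note wf = prime_factorization_wf[OF assms(5)] prime_factorization_wf[OF assms(6)]
  obtain g h where "graph_iso_map A (direct_product_list Gs) g" "graph_iso_map B (direct_product_list Hs) h"
    using assms wf digraph_iso_iff_graph_iso_map pseudo_graph_wf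
    unfolding prime_factorization_of_def by metis
  then have "\<exists>k. graph_iso_map G (direct_product_list (Gs @ Hs)) k"
    using graph_iso_map_comp[OF graph_iso_map_comp[OF assms(4) graph_iso_map_product] graph_iso_map_append]
    by blast
  moreover have "pair_wf_digraph (direct_product_list (Gs @ Hs))"
    using assms(5,6) unfolding prime_factorization_of_def direct_prime_def
    by (intro wf_direct_product_list) (auto intro: pseudo_graph_wf)
  ultimately show ?thesis
    using assms(5,6) digraph_iso_iff_graph_iso_map[OF pseudo_graph_wf[OF assms(1)]]
    unfolding prime_factorization_of_def by auto
qed

lemma graph_iso_map_arcs:
  assumes "graph_iso_map G H f" "pair_wf_digraph G" "parcs G \<noteq> {}" shows "parcs H \<noteq> {}"
proof -
  obtain u v where "(u, v) \<in> parcs G" using assms by auto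
  then have "(f u, f v) \<in> parcs H"
    using assms pair_wf_digraph.wellformed' unfolding graph_iso_map_def by metis
  then show ?thesis by blast
qed

text \<open>Split until all factors are prime. Having an arc is inherited by both factors, and it
  turns a factor with one vertex into a vertex with a loop, which is the empty product.\<close>

lemma prime_factorization_exists_nat:
  fixes G :: "nat pair_pre_digraph"
  assumes "pair_pseudo_graph G" "parcs G \<noteq> {}"
  shows "\<exists>Gs. prime_factorization_of Gs G"
  using assms
proof (induction "card (pverts G)" arbitrary: G rule: less_induct)
  case (less G)
  note G = less(2,3)
  note wf = pseudo_graph_wf[OF G(1)]
  have fin: "finite (pverts G)" using G unfolding pseudo_graph_iff by blast
  obtain u0 v0 where arc: "(u0, v0) \<in> parcs G" using G by auto
  have vert: "u0 \<in> pverts G" "v0 \<in> pverts G" using pair_wf_digraph.wellformed'[OF wf arc] by blast+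
  consider "card (pverts G) = 1" | "direct_prime G" | "card (pverts G) > 1" "\<not> direct_prime G"
    using fin vert by (metis One_nat_def card_gt_0_iff empty_iff less_one linorder_neqE_nat not_less_eq)
  then show ?case
  proof cases
    case 1
    then obtain v where v: "pverts G = {v}" by (meson card_1_singletonE)
    then have "parcs G = {(v, v)}" using arc G(1) unfolding pseudo_graph_iff by auto
    then have "graph_iso_map G (direct_product_list []) (\<lambda>_. [])"
      using v unfolding graph_iso_map_def direct_product_list_def bij_betw_def by auto
    moreover have "pair_wf_digraph (direct_product_list ([] :: nat pair_pre_digraph list))"
      by (rule wf_direct_product_list) simp
    ultimately have "prime_factorization_of [] G"
      using digraph_iso_iff_graph_iso_map[OF wf] unfolding prime_factorization_of_def by auto
    then show ?thesis ..
  next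
    case 2
    have "graph_iso_map G (direct_product_list [G]) (\<lambda>u. [u])"
      unfolding graph_iso_map_def bij_betw_def
      by (auto simp: direct_product_list_simps list_all2_Cons2 inj_on_def)
    moreover have "pair_wf_digraph (direct_product_list [G])"
      by (rule wf_direct_product_list) (simp add: wf)
    ultimately have "prime_factorization_of [G] G"
      using digraph_iso_iff_graph_iso_map[OF wf] 2 unfolding prime_factorization_of_def by auto
    then show ?thesis ..
  next
    case 3
    then obtain A B :: "nat pair_pre_digraph"
      where AB: "pair_pseudo_graph A" "pair_pseudo_graph B" "card (pverts A) \<noteq> 1" "card (pverts B) \<noteq> 1"
        and "digraph_iso (with_proj G) (with_proj (A \<times>\<^sub>g B))"
      using G unfolding direct_prime_def by blast
    then obtain f where f: "graph_iso_map G (A \<times>\<^sub>g B) f"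
      using digraph_iso_iff_graph_iso_map[OF wf pseudo_graph_wf[OF pseudo_graph_direct_product[OF AB(1,2)]]]
      by blast
    have arcs: "parcs A \<noteq> {}" "parcs B \<noteq> {}"
      using graph_iso_map_arcs[OF f wf G(2)] unfolding direct_product_def by auto
    have card: "card (pverts G) = card (pverts A) * card (pverts B)"
      using f bij_betw_same_card unfolding graph_iso_map_def card_direct_product[symmetric] by blast
    then have "card (pverts A) > 1" "card (pverts B) > 1"
      using AB 3 by (metis One_nat_def gr0I less_one linorder_neqE_nat mult_is_0 not_less_zero)+
    then have lt: "card (pverts A) < card (pverts G)" "card (pverts B) < card (pverts G)"
      using card by auto
    obtain Gs Hs where "prime_factorization_of Gs A" "prime_factorization_of Hs B"
      using less(1) lt AB arcs by blast
    then show ?thesis using prime_factorization_append[OF G(1) AB(1,2) f] by blast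
  qed
qed

text \<open>If a factor with more than one vertex has a loop, so have all of its prime factors.\<close>

lemma factor_loopless_product:
  assumes fl: "factor_loopless G"
    and G: "pair_pseudo_graph G" "pair_pseudo_graph A" "pair_pseudo_graph B" "parcs A \<noteq> {}"
    and iso: "graph_iso_map G (A \<times>\<^sub>g B) f" and loop: "(b, b) \<in> parcs B"
  shows "card (pverts B) = 1"
proof (rule ccontr)
  assume card: "card (pverts B) \<noteq> 1"
  obtain A' :: "nat pair_pre_digraph" and g where A': "pair_pseudo_graph A'" "graph_iso_map A A' g"
    using nat_copy[OF G(2)] by blast
  obtain B' :: "nat pair_pre_digraph" and h where B': "pair_pseudo_graph B'" "graph_iso_map B B' h"
    using nat_copy[OF G(3)] by blast
  have bv: "b \<in> pverts B" using pair_wf_digraph.wellformed'[OF pseudo_graph_wf[OF G(3)] loop] by blast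
  then have b': "(h b, h b) \<in> parcs B'" using loop B' unfolding graph_iso_map_def by blast
  have hb: "h b \<in> pverts B'" using bv B' unfolding graph_iso_map_def by (auto dest: bij_betwE)
  have "parcs A' \<noteq> {}" "parcs B' \<noteq> {}"
    using graph_iso_map_arcs[OF A'(2) pseudo_graph_wf] G b' by auto
  then obtain Gs Hs where fac: "prime_factorization_of Gs A'" "prime_factorization_of Hs B'"
    using prime_factorization_exists_nat A' B' by blast
  have "graph_iso_map G (A' \<times>\<^sub>g B') (map_prod g h \<circ> f)"
    using graph_iso_map_comp[OF iso graph_iso_map_product] A' B' by blast
  then have "prime_factorization_of (Gs @ Hs) G"
    using prime_factorization_append[OF G(1) A'(1) B'(1)] fac by blast
  then have lf: "\<forall>P\<in>set Hs. pair_loopfree_digraph P" using fl unfolding factor_loopless_def by auto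
  obtain k where k: "graph_iso_map B' (direct_product_list Hs) k"
    using fac(2) digraph_iso_iff_graph_iso_map[OF pseudo_graph_wf[OF B'(1)] prime_factorization_wf[OF fac(2)]]
    unfolding prime_factorization_of_def by blast
  have "card (pverts B) = card (pverts (direct_product_list Hs))"
    using k B' bij_betw_same_card unfolding graph_iso_map_def by metis
  moreover have "card (pverts (direct_product_list ([] :: nat pair_pre_digraph list))) = 1"
    by (simp add: direct_product_list_simps)
  \<comment> \<open>More than one vertex rules out the empty product, so there is a first prime
    factor to receive the loop.\<close>
  ultimately have "Hs \<noteq> []" using card by metis
  moreover have "(k (h b), k (h b)) \<in> parcs (direct_product_list Hs)"
    using k b' hb unfolding graph_iso_map_def by blast
  ultimately have "(k (h b) ! 0, k (h b) ! 0) \<in> parcs (Hs ! 0)" "Hs ! 0 \<in> set Hs"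
    by (auto simp: direct_product_list_simps)
  then show False using lf pair_loopfree_digraph.pair_no_loops by fastforce
qed

section \<open>Decompositions of factor-loopless graphs\<close>

text \<open>In the four-factor refinement, with indices \<open>(i, j)\<close> for the
  \<open>n\<close>- and \<open>m\<close>-coordinate, this operation takes the diagonal factors
  \<open>(1,1)\<close> and \<open>(2,2)\<close> from \<open>x\<close> and the off-diagonal ones from
  \<open>y\<close>.\<close>

lemma rect_band_exchange:
  assumes n: "rect_band U n" and m: "rect_band U m" and c: "commuting_on U n m"
  shows "rect_band U (\<lambda>x y. n (m x y) (m y x))"
  unfolding rect_band_def
proof (intro conjI ballI)
  note Rn = rect_bandD[OF n] and Rm = rect_bandD[OF m]
  let ?q = "\<lambda>x y. n (m x y) (m y x)"
  show "?q x y \<in> U" if "x \<in> U" "y \<in> U" for x y using that Rn(1) Rm(1) by simp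
  show "?q x x = x" if "x \<in> U" for x using that Rn Rm by simp
  have left: "m (?q x y) z = n (m x z) (m y z)" if "x \<in> U" "y \<in> U" "z \<in> U" for x y z
  proof -
    have "m (?q x y) z = m (?q x y) (n z z)" using Rn that by simp
    also have "\<dots> = n (m (m x y) z) (m (m y x) z)"
      using that Rm(1) by (intro commuting_onD[OF c])
    finally show ?thesis using Rm that by simp
  qed
  have right: "m z (?q x y) = n (m z y) (m z x)" if "x \<in> U" "y \<in> U" "z \<in> U" for x y z
  proof -
    have "m z (?q x y) = m (n z z) (?q x y)" using Rn that by simp
    also have "\<dots> = n (m z (m x y)) (m z (m y x))"
      using that Rm(1) by (intro commuting_onD[OF c])
    finally show ?thesis using Rm that by simp
  qed
  fix x y z assume U: "x \<in> U" "y \<in> U" "z \<in> U"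
  show "?q (?q x y) z = ?q x z" "?q x (?q y z) = ?q x z"
    unfolding left[OF U] right[OF U] left[OF U(2,3,1)] right[OF U(2,3,1)]
    using Rn Rm U by simp_all
qed

text \<open>The same operation \<open>q\<close> on both ends of an arc gives a factorization of the
  graph, not only of the relation. Both factors are found as layers through
  \<open>o'\<close>.\<close>

lemma graph_iso_map_decomposition:
  fixes G :: "'a pair_pre_digraph"
  assumes G: "pair_pseudo_graph G"
    and dec: "decomposition_op (pverts G) (pverts G) (\<lambda>u v. (u, v) \<in> parcs G) q q"
    and o: "o' \<in> pverts G"
  shows "graph_iso_map G (image_graph (\<lambda>x. q x o') G \<times>\<^sub>g image_graph (\<lambda>x. q o' x) G)
     (\<lambda>x. (q x o', q o' x))"
  unfolding graph_iso_map_def pverts_direct_product parcs_direct_product image_graph_simps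
proof (intro conjI ballI)
  note R = rect_bandD[OF decomposition_opD(1)[OF dec]]
  have split: "x = q a c" if "q x o' = q a o'" "q o' x = q o' c"
      "x \<in> pverts G" "a \<in> pverts G" "c \<in> pverts G" for x a c
  proof -
    have "x = q (q x o') (q o' x)" using R o that(3) by simp
    also have "\<dots> = q (q a o') (q o' c)" using that by simp
    also have "\<dots> = q a c" using R o that(3-) by simp
    finally show ?thesis .
  qed
  show "bij_betw (\<lambda>x. (q x o', q o' x)) (pverts G)
     ((\<lambda>x. q x o') ` pverts G \<times> (\<lambda>x. q o' x) ` pverts G)"
    unfolding bij_betw_def
  proof (intro conjI equalityI subsetI)
    show "inj_on (\<lambda>x. (q x o', q o' x)) (pverts G)"
    proof (rule inj_onI)
      fix x y assume "x \<in> pverts G" "y \<in> pverts G" "(q x o', q o' x) = (q y o', q o' y)"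
      then show "x = y" using split[of x y y] R by simp
    qed
    fix p assume "p \<in> (\<lambda>x. q x o') ` pverts G \<times> (\<lambda>x. q o' x) ` pverts G"
    then obtain a c where ac: "p = (q a o', q o' c)" "a \<in> pverts G" "c \<in> pverts G" by auto
    then have "p = (q (q a c) o', q o' (q a c))" "q a c \<in> pverts G" using R o by auto
    then show "p \<in> (\<lambda>x. (q x o', q o' x)) ` pverts G" by blast
  qed auto
  fix u v assume uv: "u \<in> pverts G" "v \<in> pverts G"
  show "(q u o', q v o') \<in> map_prod (\<lambda>x. q x o') (\<lambda>x. q x o') ` parcs G \<and>
      (q o' u, q o' v) \<in> map_prod (\<lambda>x. q o' x) (\<lambda>x. q o' x) ` parcs G \<longleftrightarrow> (u, v) \<in> parcs G"
    (is "?L \<longleftrightarrow> _")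
  proof
    assume ?L
    then obtain a b c d where abcd: "(a, b) \<in> parcs G" "(c, d) \<in> parcs G"
      "q u o' = q a o'" "q v o' = q b o'" "q o' u = q o' c" "q o' v = q o' d" by auto
    have V: "a \<in> pverts G" "b \<in> pverts G" "c \<in> pverts G" "d \<in> pverts G"
      using abcd pair_wf_digraph.wellformed'[OF pseudo_graph_wf[OF G]] by blast+
    have "u = q a c" "v = q b d" using split abcd uv V by blast+
    then show "(u, v) \<in> parcs G" using decomposition_opD(3)[OF dec] abcd V by blast
  qed (simp add: rev_image_eqI)
qed

text \<open>
  With rows and columns interchanged, \<open>n, n'\<close> becomes the decomposition \<open>n', n\<close>. The part on
  which the two disagree is a factor of the form \<open>R \<times> R\<^sup>T\<close>, which has a loop at every pair
  \<open>(x, w)\<close> with \<open>R x w\<close>.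
\<close>

lemma factor_loopless_self_dual:
  fixes G :: "'a pair_pre_digraph"
  defines "adj \<equiv> \<lambda>u v. (u, v) \<in> parcs G"
  assumes G: "pair_pseudo_graph G" "factor_loopless G"
    and thin: "thin_birelation (pverts G) (pverts G) adj"
    and dec: "decomposition_op (pverts G) (pverts G) adj n n'"
    and xy: "x \<in> pverts G" "y \<in> pverts G"
  shows "n x y = n' x y"
proof -
  interpret thin_birelation "pverts G" "pverts G" adj by (rule thin)
  have sym: "adj u v \<Longrightarrow> adj v u" for u v
    using G(1) unfolding adj_def pseudo_graph_iff by (auto dest: symD)
  have dec': "decomposition_op (pverts G) (pverts G) adj n' n"
    using decomposition_op_transpose[OF dec] sym unfolding decomposition_op_def by blast
  have com: "commuting_on (pverts G) n n'" by (rule strict_refinement[OF dec dec'])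
  note Rn = rect_bandD[OF decomposition_opD(1)[OF dec]]
  note Rn' = rect_bandD[OF decomposition_opD(2)[OF dec]]
  note E = decomposition_opD(3)[OF dec] decomposition_opD(3)[OF dec']
  define q where "q = (\<lambda>x y. n (n' x y) (n' y x))"
  have q_eq: "n' (n x y) (n y x) = q x y" if "x \<in> pverts G" "y \<in> pverts G" for x y
    unfolding q_def using commuting_onD[OF com] that by simp
  have "rect_band (pverts G) q"
    unfolding q_def using rect_band_exchange decomposition_opD(1)[OF dec] decomposition_opD(1)[OF dec'] com
    by blast
  moreover have "adj (q x1 x2) (q w1 w2)"
    if "x1 \<in> pverts G" "x2 \<in> pverts G" "w1 \<in> pverts G" "w2 \<in> pverts G" "adj x1 w1" "adj x2 w2"
    for x1 x2 w1 w2
  proof -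
    \<comment> \<open>Apply \<open>dec'\<close> and then \<open>dec\<close>, so that rows and
      columns see the two operations in opposite order; \<open>q_eq\<close> identifies the column
      entry with \<open>q w1 w2\<close>.\<close>
    have "adj (n (n' x1 x2) (n' x2 x1)) (n' (n w1 w2) (n w2 w1))"
      using that by (intro E Rn Rn')
    then show ?thesis unfolding q_eq[OF that(3,4)] by (simp add: q_def)
  qed
  ultimately have decq: "decomposition_op (pverts G) (pverts G) adj q q"
    unfolding decomposition_op_def by blast
  have "q o' z = o'" if o: "o' \<in> pverts G" and z: "z \<in> pverts G" for o' z
  proof -
    let ?A = "image_graph (\<lambda>x. q x o') G" and ?B = "image_graph (\<lambda>x. q o' x) G"
    have iso: "graph_iso_map G (?A \<times>\<^sub>g ?B) (\<lambda>x. (q x o', q o' x))"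
      using graph_iso_map_decomposition[OF G(1) decq[unfolded adj_def] o] .
    obtain w where w: "w \<in> pverts G" "adj z w"
      using row_nonempty[OF z] unfolding row_def by blast
    \<comment> \<open>Both ends of this arc have the \<open>(1,2)\<close> factor of \<open>z\<close>
      and the \<open>(2,1)\<close> factor of \<open>w\<close>. They agree off the diagonal, so the
      arc projects to a loop of \<open>?B\<close>.\<close>
    have "adj (n z w) (n' w z)" using E(1) z w sym by blast
    then have "(q o' (n z w), q o' (n' w z)) \<in> parcs ?B"
      unfolding image_graph_simps adj_def by (simp add: rev_image_eqI)
    moreover have "q o' (n z w) = n (n' o' z) (n' w o')"
    proof -
      have "n' o' (n z w) = n (n' o' z) (n' o' w)"
        using commuting_onD[OF com o o z w(1)] Rn(2)[OF o] by simp
      moreover have "n' (n z w) o' = n (n' z o') (n' w o')"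
        using commuting_onD[OF com z w(1) o o] Rn(2)[OF o] by simp
      ultimately show ?thesis unfolding q_def using o z w Rn Rn' by simp
    qed
    moreover have "q o' (n' w z) = n (n' o' z) (n' w o')"
      unfolding q_def using o z w Rn Rn' by simp
    ultimately have loop: "(n (n' o' z) (n' w o'), n (n' o' z) (n' w o')) \<in> parcs ?B" by simp
    have "(z, w) \<in> parcs G" using w adj_def by simp
    then have ne: "parcs ?A \<noteq> {}" unfolding image_graph_simps by blast
    have "card (pverts ?B) = 1"
      using factor_loopless_product[OF G(2,1) _ _ ne iso loop] pseudo_graph_image_graph G by blast
    then obtain b where "(\<lambda>x. q o' x) ` pverts G = {b}"
      unfolding image_graph_simps by (meson card_1_singletonE)
    then have "q o' z = q o' o'" using o z by (metis imageI singletonD)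
    then show ?thesis using rect_bandD(2)[OF decomposition_opD(1)[OF decq]] o by simp
  qed
  \<comment> \<open>The off-diagonal factors are now trivial, and on the diagonal ones
    \<open>n\<close> and \<open>n'\<close> make the same choice.\<close>
  then have "x = n (n' x y) (n' y x)" "y = n (n' y x) (n' x y)" using xy unfolding q_def by metis+
  then have "n x y = n (n (n' x y) (n' y x)) (n (n' y x) (n' x y))" by simp
  also have "\<dots> = n' x y" using Rn Rn' xy by simp
  finally show ?thesis .
qed

section \<open>Products with a bipartite graph\<close>

lemma connected_walk:
  assumes "pair_pseudo_graph G" "connected (with_proj G)" "u \<in> pverts G" "v \<in> pverts G"
  shows "(u, v) \<in> (parcs G)\<^sup>*"
proof -
  have sub: "parcs (mk_symmetric (with_proj G)) \<subseteq> parcs G"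
    using assms(1) unfolding mk_symmetric_def pseudo_graph_iff by (auto dest: symD)
  have "u \<rightarrow>\<^sup>*\<^bsub>with_proj (mk_symmetric (with_proj G))\<^esub> v"
    using assms(2-4) unfolding connected_def strongly_connected_def by (simp add: mk_symmetric_def)
  then have "(u, v) \<in> (parcs (mk_symmetric (with_proj G)))\<^sup>*"
    unfolding reachable_def by (simp add: rtrancl_on_rtranclI)
  then show ?thesis using rtrancl_mono[OF sub] by blast
qed

section \<open>Walks and their parity\<close>

lemma relpow_odd_colour:
  assumes "\<And>u v. (u, v) \<in> R \<Longrightarrow> c u \<noteq> (c v :: bool)" and "(u, v) \<in> R ^^ n"
  shows "c u = c v \<longleftrightarrow> even n"
  using assms(2)
proof (induction n arbitrary: v)
  case (Suc n)
  then obtain w where "(u, w) \<in> R ^^ n" "(w, v) \<in> R" by auto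
  then show ?case using Suc.IH[of w] assms(1)[of w v] by auto
qed simp

lemma relpow_sym: "sym R \<Longrightarrow> (u, v) \<in> R ^^ n \<Longrightarrow> (v, u) \<in> R ^^ n"
proof (induction n arbitrary: u v)
  case (Suc n)
  then obtain w where "(u, w) \<in> R ^^ n" "(w, v) \<in> R" by auto
  then have "(w, u) \<in> R ^^ n" "(v, w) \<in> R" using Suc by (auto dest: symD)
  then show ?case by (metis relpow_Suc_I2)
qed simp

lemma relpow_trans: "(u, v) \<in> R ^^ m \<Longrightarrow> (v, w) \<in> R ^^ n \<Longrightarrow> (u, w) \<in> R ^^ (m + n)"
  by (auto simp: relpow_add)

text \<open>Colour each vertex by whether an even walk from \<open>u\<close> reaches it. This is not
  a proper colouring, and a monochromatic arc closes an odd walk at \<open>u\<close>; prefixing it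
  corrects the parity of any walk to \<open>v\<close>.\<close>

lemma nonbipartite_even_walk:
  assumes G: "pair_pseudo_graph G" "connected (with_proj G)" "\<not> bipartite G"
    and uv: "u \<in> pverts G" "v \<in> pverts G"
  shows "\<exists>k. (u, v) \<in> parcs G ^^ (2 * k)"
proof -
  let ?R = "parcs G"
  have sym: "sym ?R" and sub: "?R \<subseteq> pverts G \<times> pverts G" using G unfolding pseudo_graph_iff by auto
  have walk: "\<exists>n. (x, y) \<in> ?R ^^ n" if "x \<in> pverts G" "y \<in> pverts G" for x y
    using connected_walk[OF G(1,2) that] rtrancl_imp_relpow by blast
  define c where "c x \<longleftrightarrow> (\<exists>n. even n \<and> (u, x) \<in> ?R ^^ n)" for x
  obtain x y where xy: "(x, y) \<in> ?R" "c x = c y"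
    using G(3) unfolding bipartite_def by blast
  then have V: "x \<in> pverts G" "y \<in> pverts G" using sub by auto
  obtain i j where ij: "(u, x) \<in> ?R ^^ i" "(u, y) \<in> ?R ^^ j" "even i = even j"
  proof (cases "c x")
    case True
    then show ?thesis using that xy unfolding c_def by blast
  next
    case False
    obtain i j where "(u, x) \<in> ?R ^^ i" "(u, y) \<in> ?R ^^ j" using walk uv V by blast
    moreover from this have "odd i" "odd j" using False xy(2) unfolding c_def by blast+
    ultimately show ?thesis using that by blast
  qed
  have "(u, u) \<in> ?R ^^ (i + (1 + j))"
    using relpow_trans[OF ij(1) relpow_trans[where m = 1 and u = x and v = y]] xy relpow_sym[OF sym ij(2)] by simp
  moreover obtain n where n: "(u, v) \<in> ?R ^^ n" using walk uv by blast
  ultimately have "(u, v) \<in> ?R ^^ (i + (1 + j) + n)" by (rule relpow_trans)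
  moreover have "even n \<or> even (i + (1 + j) + n)" using ij(3) by auto
  ultimately obtain l where "even l" "(u, v) \<in> ?R ^^ l" using n by blast
  then show ?thesis by (auto elim: evenE)
qed

lemma no_isolated_vertex:
  assumes "(a, b) \<in> R" "(v, a) \<in> R\<^sup>*" shows "\<exists>w. (v, w) \<in> R"
  using assms(2,1) by (cases rule: converse_rtranclE) auto

lemma relpow_extend:
  assumes "sym R" "(u, v) \<in> R ^^ n" "(v, w) \<in> R" shows "(u, v) \<in> R ^^ (n + 2 * k)"
proof (induction k)
  case (Suc k)
  have "(v, v) \<in> R ^^ 2" using assms by (auto simp: numeral_2_eq_2 dest: symD)
  from relpow_trans[OF Suc this] show ?case by (simp add: add.commute add.left_commute)
qed (simp add: assms)

lemma relpow_direct_product: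
  "(u, x) \<in> parcs G ^^ n \<Longrightarrow> (v, y) \<in> parcs H ^^ n \<Longrightarrow> ((u, v), (x, y)) \<in> parcs (G \<times>\<^sub>g H) ^^ n"
proof (induction n arbitrary: x y)
  case (Suc n)
  then obtain x' y' where "(u, x') \<in> parcs G ^^ n" "(x', x) \<in> parcs G"
    "(v, y') \<in> parcs H ^^ n" "(y', y) \<in> parcs H" by auto
  then have "((u, v), (x', y')) \<in> parcs (G \<times>\<^sub>g H) ^^ n" "((x', y'), (x, y)) \<in> parcs (G \<times>\<^sub>g H)"
    using Suc.IH by (auto simp: parcs_direct_product)
  then show ?case by auto
qed simp

lemma linked_even_walk:
  assumes "(x, y) \<in> R ^^ (2 * k)" "x \<in> U"
    and "\<And>u w. (u, w) \<in> R \<Longrightarrow> u \<in> U \<Longrightarrow> w \<in> W"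
    and "\<And>w u. (w, u) \<in> R \<Longrightarrow> w \<in> W \<Longrightarrow> u \<in> U \<and> (u, w) \<in> R"
  shows "(\<lambda>u v. u \<in> U \<and> v \<in> U \<and> row W (\<lambda>u w. (u, w) \<in> R) u \<inter> row W (\<lambda>u w. (u, w) \<in> R) v \<noteq> {})\<^sup>*\<^sup>* x y
     \<and> y \<in> U"
  using assms(1)
proof (induction k arbitrary: y)
  case 0
  then show ?case using assms by simp
next
  case (Suc k)
  then obtain z w where zw: "(x, z) \<in> R ^^ (2 * k)" "(z, w) \<in> R" "(w, y) \<in> R" by auto
  from Suc.IH[OF zw(1)] have z: "z \<in> U" by blast
  then have "w \<in> W" "y \<in> U" "(y, w) \<in> R" using assms(3,4) zw by blast+
  then have "w \<in> row W (\<lambda>u w. (u, w) \<in> R) z \<inter> row W (\<lambda>u w. (u, w) \<in> R) y"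
    using zw unfolding row_def by blast
  then show ?case using Suc.IH[OF zw(1)] z \<open>y \<in> U\<close>
    by (auto intro: rtranclp.rtrancl_into_rtrancl)
qed

lemma twin_free_row:
  assumes "pair_pseudo_graph G" "twin_free G" "u \<in> pverts G" "v \<in> pverts G"
    and "\<And>w. (u, w) \<in> parcs G \<longleftrightarrow> (v, w) \<in> parcs G"
  shows "u = v"
  using assms unfolding twin_free_def neighbourhood_def by auto

section \<open>Automorphisms of a product with a coloured factor\<close>

lemma automorphismsD:
  assumes "f \<in> automorphisms G"
  shows "f permutes pverts G"
    and "u \<in> pverts G \<Longrightarrow> v \<in> pverts G \<Longrightarrow> (f u, f v) \<in> parcs G \<longleftrightarrow> (u, v) \<in> parcs G"
  using assms unfolding automorphisms_def by blast+

lemma componentwise_automorphism: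
  assumes "f \<in> automorphisms G" "g \<in> automorphisms H"
  shows "componentwise G H f g \<in> automorphisms (G \<times>\<^sub>g H)"
proof -
  note f = automorphismsD[OF assms(1)] and g = automorphismsD[OF assms(2)]
  have "bij_betw (map_prod f g) (pverts (G \<times>\<^sub>g H)) (pverts (G \<times>\<^sub>g H))"
    unfolding pverts_direct_product
    by (intro bij_betw_map_prod permutes_imp_bij f(1) g(1))
  then have "bij_betw (componentwise G H f g) (pverts (G \<times>\<^sub>g H)) (pverts (G \<times>\<^sub>g H))"
    by (subst bij_betw_cong[where g = "map_prod f g"]) (auto simp: componentwise_def)
  then have "componentwise G H f g permutes pverts (G \<times>\<^sub>g H)"
    by (intro bij_imp_permutes) (auto simp: componentwise_def)
  then show ?thesis using f(2) g(2)
    unfolding automorphisms_def componentwise_def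
    by (auto simp: pverts_direct_product parcs_direct_product)
qed

lemma stable_pair_iff:
  "stable_pair G H \<longleftrightarrow> (\<forall>p \<in> automorphisms (G \<times>\<^sub>g H). \<exists>f\<in>automorphisms G. \<exists>g\<in>automorphisms H.
     p = componentwise G H f g)"
  unfolding stable_pair_def using componentwise_automorphism by blast

text \<open>Bipartiteness enters as a fixed colouring and its failure as even walks. The locale
  serves for the given pair and again for \<open>G\<close> and \<open>K2\<close>, coloured by
  \<open>id\<close>.\<close>

locale coloured_pair =
  fixes G :: "'a pair_pre_digraph" and H :: "'b pair_pre_digraph" and c :: "'b \<Rightarrow> bool"
  assumes graphs: "pair_pseudo_graph G" "pair_pseudo_graph H"
    and even_walk: "u \<in> pverts G \<Longrightarrow> v \<in> pverts G \<Longrightarrow> \<exists>k. (u, v) \<in> parcs G ^^ (2 * k)"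
    and arcs_G: "parcs G \<noteq> {}"
    and walk_H: "s \<in> pverts H \<Longrightarrow> t \<in> pverts H \<Longrightarrow> (s, t) \<in> (parcs H)\<^sup>*"
    and arcs_H: "parcs H \<noteq> {}"
    and colour: "(s, t) \<in> parcs H \<Longrightarrow> c s \<noteq> c t"
begin

lemma sym_G: "(u, v) \<in> parcs G \<Longrightarrow> (v, u) \<in> parcs G" and sym_H: "(s, t) \<in> parcs H \<Longrightarrow> (t, s) \<in> parcs H"
  using graphs unfolding pseudo_graph_iff by (auto dest: symD)

lemma arc_G: "(u, v) \<in> parcs G \<Longrightarrow> u \<in> pverts G" "(u, v) \<in> parcs G \<Longrightarrow> v \<in> pverts G"
  and arc_H: "(s, t) \<in> parcs H \<Longrightarrow> s \<in> pverts H" "(s, t) \<in> parcs H \<Longrightarrow> t \<in> pverts H"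
  using graphs unfolding pseudo_graph_iff by auto

lemma nbr_G: "u \<in> pverts G \<Longrightarrow> \<exists>v. (u, v) \<in> parcs G"
proof -
  assume u: "u \<in> pverts G"
  obtain a b where ab: "(a, b) \<in> parcs G" using arcs_G by auto
  then obtain k where "(u, a) \<in> parcs G ^^ (2 * k)" using even_walk[OF u] arc_G by blast
  then show ?thesis using no_isolated_vertex[OF ab] by (meson relpow_imp_rtrancl)
qed

lemma nbr_H: "s \<in> pverts H \<Longrightarrow> \<exists>t. (s, t) \<in> parcs H"
  using arcs_H no_isolated_vertex walk_H arc_H by (metis equals0I surj_pair)

lemma colour_nonempty: "\<exists>s t. (s, t) \<in> parcs H \<and> c s = b \<and> c t = (\<not> b)"
proof -
  obtain s t where "(s, t) \<in> parcs H" using arcs_H by auto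
  then show ?thesis using colour sym_H by (metis (full_types))
qed

abbreviation part :: "bool \<Rightarrow> ('a \<times> 'b) set" where
  "part b \<equiv> pverts G \<times> {s \<in> pverts H. c s = b}"

lemma product_arc:
  assumes "(x, y) \<in> parcs (G \<times>\<^sub>g H)"
  shows "x \<in> pverts (G \<times>\<^sub>g H)" "y \<in> pverts (G \<times>\<^sub>g H)" "(y, x) \<in> parcs (G \<times>\<^sub>g H)"
    "c (snd x) \<noteq> c (snd y)"
  using assms arc_G arc_H colour
  by (cases x; cases y; auto simp: parcs_direct_product pverts_direct_product intro: sym_G sym_H)+

text \<open>Equal colours make the walk in \<open>H\<close> even as well. Going back and forth along
  a last arc brings both walks to the same length.\<close>

lemma product_even_walk:
  assumes "x \<in> pverts (G \<times>\<^sub>g H)" "y \<in> pverts (G \<times>\<^sub>g H)" "c (snd x) = c (snd y)"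
  shows "\<exists>k. (x, y) \<in> parcs (G \<times>\<^sub>g H) ^^ (2 * k)"
proof -
  obtain u s v t where xy: "x = (u, s)" "y = (v, t)" by (cases x; cases y)
  then have V: "u \<in> pverts G" "v \<in> pverts G" "s \<in> pverts H" "t \<in> pverts H"
    using assms by (auto simp: pverts_direct_product)
  have sym: "sym (parcs G)" "sym (parcs H)" using graphs unfolding pseudo_graph_iff by auto
  obtain i where i: "(u, v) \<in> parcs G ^^ (2 * i)" using even_walk V by blast
  obtain n where n: "(s, t) \<in> parcs H ^^ n" using walk_H V rtrancl_imp_relpow by blast
  then have "even n" using relpow_odd_colour[of "parcs H" c s t n] colour assms(3) xy by simp
  then obtain j where j: "n = 2 * j" by blast
  obtain v' t' where "(v, v') \<in> parcs G" "(t, t') \<in> parcs H" using nbr_G nbr_H V by blast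
  then have "(u, v) \<in> parcs G ^^ (2 * i + 2 * j)" "(s, t) \<in> parcs H ^^ (n + 2 * i)"
    using relpow_extend[OF sym(1) i] relpow_extend[OF sym(2) n] by blast+
  then have "(x, y) \<in> parcs (G \<times>\<^sub>g H) ^^ (2 * (i + j))"
    unfolding xy using j by (intro relpow_direct_product) (auto simp: add.commute algebra_simps)
  then show ?thesis by blast
qed

lemma automorphism_walk:
  assumes "\<phi> \<in> automorphisms (G \<times>\<^sub>g H)" "(x, y) \<in> parcs (G \<times>\<^sub>g H) ^^ n"
  shows "(\<phi> x, \<phi> y) \<in> parcs (G \<times>\<^sub>g H) ^^ n"
  using assms(2)
proof (induction n arbitrary: y)
  case (Suc n)
  then obtain z where z: "(x, z) \<in> parcs (G \<times>\<^sub>g H) ^^ n" "(z, y) \<in> parcs (G \<times>\<^sub>g H)" by auto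
  then have "(\<phi> z, \<phi> y) \<in> parcs (G \<times>\<^sub>g H)"
    using automorphismsD(2)[OF assms(1)] product_arc by blast
  then show ?case using Suc.IH[OF z(1)] by (rule relpow_Suc_I[rotated])
qed simp

text \<open>Vertices of equal colour are joined by an even walk, which an automorphism preserves.
  For unequal colours, a neighbour of \<open>x\<close> has the colour of \<open>y\<close>. So an
  automorphism fixes or swaps the two sides.\<close>

lemma automorphism_colour:
  assumes \<phi>: "\<phi> \<in> automorphisms (G \<times>\<^sub>g H)"
    and xy: "x \<in> pverts (G \<times>\<^sub>g H)" "y \<in> pverts (G \<times>\<^sub>g H)"
  shows "c (snd (\<phi> x)) = c (snd (\<phi> y)) \<longleftrightarrow> c (snd x) = c (snd y)"
proof -
  have same: "c (snd (\<phi> x)) = c (snd (\<phi> y))"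
    if xy: "x \<in> pverts (G \<times>\<^sub>g H)" "y \<in> pverts (G \<times>\<^sub>g H)" "c (snd x) = c (snd y)" for x y
  proof -
    obtain k where "(x, y) \<in> parcs (G \<times>\<^sub>g H) ^^ (2 * k)" using product_even_walk[OF xy] by blast
    from automorphism_walk[OF \<phi> this] show ?thesis
      using relpow_odd_colour[of "parcs (G \<times>\<^sub>g H)" "\<lambda>x. c (snd x)" "\<phi> x" "\<phi> y" "2 * k"] product_arc(4) by simp
  qed
  show ?thesis
  proof (cases "c (snd x) = c (snd y)")
    case False
    obtain u s where us: "x = (u, s)" by (cases x)
    then obtain v t where vt: "(u, v) \<in> parcs G" "(s, t) \<in> parcs H"
      using nbr_G nbr_H xy(1) by (auto simp: pverts_direct_product) blast
    then have arc: "(x, (v, t)) \<in> parcs (G \<times>\<^sub>g H)" using us by (simp add: parcs_direct_product)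
    note p = product_arc[OF arc]
    have "(\<phi> x, \<phi> (v, t)) \<in> parcs (G \<times>\<^sub>g H)" using arc automorphismsD(2)[OF \<phi>] p by blast
    then have "c (snd (\<phi> x)) \<noteq> c (snd (\<phi> (v, t)))" by (rule product_arc(4))
    moreover have "c (snd (\<phi> (v, t))) = c (snd (\<phi> y))"
      using same[OF p(2) xy(2)] p(4) False by auto
    ultimately show ?thesis using False by simp
  qed (use same xy in blast)
qed

lemma thin_birelation_G:
  assumes "twin_free G"
  shows "thin_birelation (pverts G) (pverts G) (\<lambda>u v. (u, v) \<in> parcs G)"
proof
  show "finite (pverts G)" using graphs unfolding pseudo_graph_iff by blast
  fix u v assume uv: "u \<in> pverts G" "v \<in> pverts G"
  show "row (pverts G) (\<lambda>u v. (u, v) \<in> parcs G) u \<noteq> {}"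
    using nbr_G[OF uv(1)] arc_G unfolding row_def by blast
  show "u = v" if "row (pverts G) (\<lambda>u v. (u, v) \<in> parcs G) u = row (pverts G) (\<lambda>u v. (u, v) \<in> parcs G) v"
    using twin_free_row[OF graphs(1) assms uv] that arc_G unfolding row_def by blast
  obtain k where "(u, v) \<in> parcs G ^^ (2 * k)" using even_walk uv by blast
  from linked_even_walk[OF this uv(1), of "pverts G"]
  show "(\<lambda>u v. u \<in> pverts G \<and> v \<in> pverts G \<and> row (pverts G) (\<lambda>u v. (u, v) \<in> parcs G) u \<inter>
      row (pverts G) (\<lambda>u v. (u, v) \<in> parcs G) v \<noteq> {})\<^sup>*\<^sup>* u v"
    using arc_G sym_G by blast
qed

lemma thin_birelation_product:
  assumes "twin_free G" "twin_free H"
  shows "thin_birelation (part b) (part (\<not> b)) (\<lambda>x y. (x, y) \<in> parcs (G \<times>\<^sub>g H))"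
proof
  let ?E = "\<lambda>x y. (x, y) \<in> parcs (G \<times>\<^sub>g H)"
  show "finite (part (\<not> b))" using graphs unfolding pseudo_graph_iff by auto
  fix x y assume xy: "x \<in> part b" "y \<in> part b"
  obtain u s v t where eq: "x = (u, s)" "y = (v, t)" by (cases x; cases y)
  have V: "u \<in> pverts G" "v \<in> pverts G" "s \<in> pverts H" "t \<in> pverts H" "c s = b" "c t = b"
    using xy eq by auto
  obtain u' v' s' t' where nb: "(u, u') \<in> parcs G" "(v, v') \<in> parcs G" "(s, s') \<in> parcs H" "(t, t') \<in> parcs H"
    using nbr_G nbr_H V by meson
  have row: "(a, r) \<in> row (part (\<not> b)) ?E (u, s) \<longleftrightarrow> (u, a) \<in> parcs G \<and> (s, r) \<in> parcs H"
    if "c s = b" for a r u s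
    unfolding row_def using colour[of s r] arc_G[of u a] arc_H[of s r] that
    by (auto simp: parcs_direct_product)
  show "row (part (\<not> b)) ?E x \<noteq> {}" using row[of s u' s' u] nb V eq by blast
  show "x = y" if "row (part (\<not> b)) ?E x = row (part (\<not> b)) ?E y"
  proof -
    have *: "(u, a) \<in> parcs G \<and> (s, r) \<in> parcs H \<longleftrightarrow> (v, a) \<in> parcs G \<and> (t, r) \<in> parcs H" for a r
      using row[of s a r u, OF V(5)] row[of t a r v, OF V(6)] that eq by simp
    have "u = v" by (rule twin_free_row[OF graphs(1) assms(1) V(1,2)]) (use * nb in blast)
    moreover have "s = t" by (rule twin_free_row[OF graphs(2) assms(2) V(3,4)]) (use * nb in blast)
    ultimately show ?thesis using eq by simp
  qed
  obtain k where k: "(x, y) \<in> parcs (G \<times>\<^sub>g H) ^^ (2 * k)"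
    using product_even_walk[of x y] xy by (auto simp: pverts_direct_product)
  have "w \<in> part (\<not> b)" if "(z, w) \<in> parcs (G \<times>\<^sub>g H)" "z \<in> part b" for z w b
    using product_arc[OF that(1)] that(2) by (auto simp: pverts_direct_product)
  note step = this
  have step_back: "z \<in> part b \<and> (z, w) \<in> parcs (G \<times>\<^sub>g H)"
    if "(w, z) \<in> parcs (G \<times>\<^sub>g H)" "w \<in> part (\<not> b)" for w z
    using step[OF that] product_arc(3)[OF that(1)] by simp
  from linked_even_walk[OF k xy(1) step step_back]
  show "(\<lambda>u v. u \<in> part b \<and> v \<in> part b \<and> row (part (\<not> b)) ?E u \<inter> row (part (\<not> b)) ?E v \<noteq> {})\<^sup>*\<^sup>* x y"
    by (rule conjunct1)
qed

text \<open>The pair \<open>\<alpha> True\<close>, \<open>\<alpha> False\<close> is a two-fold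
  automorphism of \<open>G\<close>: one permutation for each end of an arc. The colour of the second
  coordinate decides which of them acts.\<close>

lemma twist_automorphism:
  assumes bij: "\<And>b. bij_betw (\<alpha> b) (pverts G) (pverts G)"
    and adj: "\<And>b u v. u \<in> pverts G \<Longrightarrow> v \<in> pverts G \<Longrightarrow>
      (\<alpha> b u, \<alpha> (\<not> b) v) \<in> parcs G \<longleftrightarrow> (u, v) \<in> parcs G"
  shows "(\<lambda>p. if p \<in> pverts (G \<times>\<^sub>g H) then (\<alpha> (c (snd p)) (fst p), snd p) else p)
    \<in> automorphisms (G \<times>\<^sub>g H)" (is "?\<chi> \<in> _")
proof -
  have "inj_on ?\<chi> (pverts (G \<times>\<^sub>g H))"
    using bij unfolding inj_on_def bij_betw_def by (auto simp: pverts_direct_product)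
  moreover have "?\<chi> ` pverts (G \<times>\<^sub>g H) \<subseteq> pverts (G \<times>\<^sub>g H)"
    using bij_betw_apply[OF bij] by (auto simp: pverts_direct_product)
  moreover have "finite (pverts (G \<times>\<^sub>g H))"
    using pseudo_graph_direct_product[OF graphs] unfolding pseudo_graph_iff by blast
  ultimately have "bij_betw ?\<chi> (pverts (G \<times>\<^sub>g H)) (pverts (G \<times>\<^sub>g H))"
    unfolding bij_betw_def using endo_inj_surj by blast
  then have "?\<chi> permutes pverts (G \<times>\<^sub>g H)" by (rule bij_imp_permutes) simp
  moreover have "(?\<chi> x, ?\<chi> y) \<in> parcs (G \<times>\<^sub>g H) \<longleftrightarrow> (x, y) \<in> parcs (G \<times>\<^sub>g H)"
    if xy: "x \<in> pverts (G \<times>\<^sub>g H)" "y \<in> pverts (G \<times>\<^sub>g H)" for x y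
  proof -
    obtain u s v t where eq: "x = (u, s)" "y = (v, t)" by (cases x; cases y)
    have "(\<alpha> (c s) u, \<alpha> (c t) v) \<in> parcs G \<longleftrightarrow> (u, v) \<in> parcs G" if "(s, t) \<in> parcs H"
      using adj[of u v "c s"] colour[OF that] xy eq by (auto simp: pverts_direct_product)
    then show ?thesis using xy eq by (auto simp: parcs_direct_product)
  qed
  ultimately show ?thesis unfolding automorphisms_def by blast
qed

end

section \<open>Exchanged factors of an automorphism\<close>

lemma automorphisms_inv:
  assumes "f \<in> automorphisms G" shows "inv f \<in> automorphisms G"
proof -
  note f = automorphismsD[OF assms]
  have p: "inv f permutes pverts G" using f(1) by (rule permutes_inv)
  moreover have "(inv f u, inv f v) \<in> parcs G \<longleftrightarrow> (u, v) \<in> parcs G"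
    if "u \<in> pverts G" "v \<in> pverts G" for u v
    using f(2)[of "inv f u" "inv f v"] that permutes_in_image[OF p] permutes_inverses[OF f(1)] by simp
  ultimately show ?thesis unfolding automorphisms_def by blast
qed

locale pair_automorphism = coloured_pair G H c
  for G :: "'a pair_pre_digraph" and H :: "'b pair_pre_digraph" and c +
  fixes \<phi> :: "'a \<times> 'b \<Rightarrow> 'a \<times> 'b"
  assumes aut: "\<phi> \<in> automorphisms (G \<times>\<^sub>g H)"
    and twin_free: "twin_free G" "twin_free H"
    and loopless: "factor_loopless G"
begin

abbreviation "\<psi> \<equiv> inv \<phi>"
abbreviation "prod_arcs \<equiv> parcs (G \<times>\<^sub>g H)"
abbreviation "Z \<equiv> pverts (G \<times>\<^sub>g H)"

lemma aut_inv: "\<psi> \<in> automorphisms (G \<times>\<^sub>g H)"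
  by (rule automorphisms_inv[OF aut])

lemma \<phi>_\<psi> [simp]: "\<phi> (\<psi> x) = x" "\<psi> (\<phi> x) = x"
  using permutes_inverses[OF automorphismsD(1)[OF aut]] by auto

lemma \<phi>_in [simp]: "\<phi> x \<in> Z \<longleftrightarrow> x \<in> Z" and \<psi>_in [simp]: "\<psi> x \<in> Z \<longleftrightarrow> x \<in> Z"
  using permutes_in_image[OF automorphismsD(1)[OF aut]] permutes_in_image[OF automorphismsD(1)[OF aut_inv]]
  by blast+

lemma \<phi>_arc: "(x, y) \<in> prod_arcs \<Longrightarrow> (\<phi> x, \<phi> y) \<in> prod_arcs" and \<psi>_arc: "(x, y) \<in> prod_arcs \<Longrightarrow> (\<psi> x, \<psi> y) \<in> prod_arcs"
  using automorphismsD(2)[OF aut] automorphismsD(2)[OF aut_inv] product_arc(1,2) by blast+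

lemma pair_in_Z: "(u, s) \<in> Z \<longleftrightarrow> u \<in> pverts G \<and> s \<in> pverts H"
  by (simp add: pverts_direct_product)

lemma Z_iff: "x \<in> Z \<longleftrightarrow> fst x \<in> pverts G \<and> snd x \<in> pverts H"
  by (cases x) (simp add: pverts_direct_product)

lemma arcs_iff: "(x, y) \<in> prod_arcs \<longleftrightarrow> (fst x, fst y) \<in> parcs G \<and> (snd x, snd y) \<in> parcs H"
  by (cases x; cases y) (simp add: parcs_direct_product)

lemma part_iff: "x \<in> part b \<longleftrightarrow> x \<in> Z \<and> c (snd x) = b"
  by (cases x) (auto simp: pverts_direct_product)

lemmas \<phi>_colour = automorphism_colour[OF aut] and \<psi>_colour = automorphism_colour[OF aut_inv]

definition mix :: "'a \<times> 'b \<Rightarrow> 'a \<times> 'b \<Rightarrow> 'a \<times> 'b" where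
  "mix x y = (fst x, snd y)"

text \<open>The decomposition of the product seen after \<open>\<phi>\<close>, conjugated back so
  that it lives on the same vertices as \<open>mix\<close>.\<close>

definition mix\<phi> :: "'a \<times> 'b \<Rightarrow> 'a \<times> 'b \<Rightarrow> 'a \<times> 'b" where
  "mix\<phi> x y = \<psi> (mix (\<phi> x) (\<phi> y))"

lemma mix_simps [simp]: "fst (mix x y) = fst x" "snd (mix x y) = snd y"
  "mix (mix x y) z = mix x z" "mix x (mix y z) = mix x z" "mix x x = x"
  unfolding mix_def by auto

lemma \<phi>_mix\<phi> [simp]: "\<phi> (mix\<phi> x y) = mix (\<phi> x) (\<phi> y)"
  unfolding mix\<phi>_def by simp

lemma mix\<phi>_simps [simp]:
  "mix\<phi> (mix\<phi> x y) z = mix\<phi> x z" "mix\<phi> x (mix\<phi> y z) = mix\<phi> x z" "mix\<phi> x x = x"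
  unfolding mix\<phi>_def by auto

lemma mix_in [simp]: "x \<in> Z \<Longrightarrow> y \<in> Z \<Longrightarrow> mix x y \<in> Z"
  and mix\<phi>_in [simp]: "x \<in> Z \<Longrightarrow> y \<in> Z \<Longrightarrow> mix\<phi> x y \<in> Z"
  unfolding mix\<phi>_def by (auto simp: Z_iff[of "mix _ _"]) (simp_all add: Z_iff[symmetric] Z_iff[THEN iffD1])

lemma mix\<phi>_colour: "x \<in> Z \<Longrightarrow> y \<in> Z \<Longrightarrow> c (snd (mix\<phi> x y)) = c (snd y)"
  using \<phi>_colour[of "mix\<phi> x y" y] by simp

lemma decomposition_mix:
  "decomposition_op (part b) (part (\<not> b)) (\<lambda>x y. (x, y) \<in> prod_arcs) mix mix"
  unfolding decomposition_op_def rect_band_def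
  by (auto simp: part_iff simp del: mem_Sigma_iff) (auto simp: arcs_iff)

lemma decomposition_mix\<phi>:
  "decomposition_op (part b) (part (\<not> b)) (\<lambda>x y. (x, y) \<in> prod_arcs) mix\<phi> mix\<phi>"
proof -
  have "(mix\<phi> x1 x2, mix\<phi> w1 w2) \<in> prod_arcs" if "(x1, w1) \<in> prod_arcs" "(x2, w2) \<in> prod_arcs" for x1 x2 w1 w2
  proof -
    have "(mix (\<phi> x1) (\<phi> x2), mix (\<phi> w1) (\<phi> w2)) \<in> prod_arcs"
      using \<phi>_arc[OF that(1)] \<phi>_arc[OF that(2)] by (simp add: arcs_iff)
    then show ?thesis unfolding mix\<phi>_def by (rule \<psi>_arc)
  qed
  then show ?thesis unfolding decomposition_op_def rect_band_def
    by (auto simp: part_iff mix\<phi>_colour simp del: mem_Sigma_iff)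
qed

text \<open>Strict refinement on a single colour class, whose vertices are the rows of the relation;
  this is why all four points share a colour.\<close>

lemma mix_commute:
  assumes "x \<in> Z" "x' \<in> Z" "y \<in> Z" "y' \<in> Z"
    and "c (snd x') = c (snd x)" "c (snd y) = c (snd x)" "c (snd y') = c (snd x)"
  shows "mix\<phi> (mix x x') (mix y y') = mix (mix\<phi> x y) (mix\<phi> x' y')"
proof -
  interpret thin_birelation "part (c (snd x))" "part (\<not> c (snd x))" "\<lambda>x y. (x, y) \<in> prod_arcs"
    by (rule thin_birelation_product[OF twin_free])
  show ?thesis
    by (rule commuting_onD[OF strict_refinement[OF decomposition_mix decomposition_mix\<phi>]])
      (use assms in \<open>simp_all only: part_iff\<close>)
qed

text \<open>
  \<open>opG t\<close> is the decomposition \<open>mix\<close> carried over by \<open>\<phi>\<close> to the layer \<open>G \<times> {t}\<close>. Its second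
  coordinate is the part of \<open>G\<close> that \<open>\<phi>\<close> takes from \<open>H\<close>; \<open>opH\<close> below is its counterpart on \<open>H\<close>,
  where the exchanged part is the first coordinate.
\<close>

definition opG :: "'b \<Rightarrow> 'a \<Rightarrow> 'a \<Rightarrow> 'a" where
  "opG t u v = fst (\<phi> (mix (\<psi> (u, t)) (\<psi> (v, t))))"

text \<open>Replacing the second coordinates of \<open>\<phi> x\<close> and \<open>\<phi> y\<close>
  by \<open>t\<close> is an application of \<open>mix\<phi>\<close> with a fixed point
  \<open>o'\<close>. It commutes with \<open>mix\<close>, so the first coordinate of the result
  depends on the first coordinates of \<open>\<phi> x\<close> and \<open>\<phi> y\<close>
  only.\<close>

lemma opG_hom:
  assumes "x \<in> Z" "y \<in> Z" "c (snd x) = c (snd y)" "t \<in> pverts H" "c t = c (snd (\<phi> x))"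
  shows "fst (\<phi> (mix x y)) = opG t (fst (\<phi> x)) (fst (\<phi> y))"
proof -
  define o' where "o' = \<psi> (fst (\<phi> x), t)"
  have V: "fst (\<phi> x) \<in> pverts G" "fst (\<phi> y) \<in> pverts G" using assms \<phi>_in Z_iff by blast+
  then have o: "o' \<in> Z" using assms by (simp add: pair_in_Z o'_def)
  have co: "c (snd o') = c (snd x)" using \<phi>_colour[OF o assms(1)] assms(5) by (simp add: o'_def)
  have "\<psi> (fst (\<phi> z), t) = mix\<phi> z o'" for z unfolding mix\<phi>_def mix_def o'_def by simp
  then have "opG t (fst (\<phi> x)) (fst (\<phi> y)) = fst (\<phi> (mix (mix\<phi> x o') (mix\<phi> y o')))"
    unfolding opG_def by simp
  also have "mix (mix\<phi> x o') (mix\<phi> y o') = mix\<phi> (mix x y) (mix o' o')"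
    by (rule mix_commute[symmetric]) (use assms o co in simp_all)
  finally show ?thesis by simp
qed

lemma rect_band_opG:
  assumes t: "t \<in> pverts H" shows "rect_band (pverts G) (opG t)"
proof -
  have in_Z: "\<psi> (u, t) \<in> Z" if "u \<in> pverts G" for u using that t by (simp add: pair_in_Z)
  have col: "c (snd (\<psi> (u, t))) = c (snd (\<psi> (v, t)))" if "u \<in> pverts G" "v \<in> pverts G" for u v
    using \<psi>_colour[of "(u, t)" "(v, t)"] that t by (simp add: pair_in_Z)
  have hom: "opG t (fst (\<phi> x)) (fst (\<phi> y)) = fst (\<phi> (mix x y))"
    if "x \<in> Z" "y \<in> Z" "u \<in> pverts G" "c (snd x) = c (snd (\<psi> (u, t)))" "c (snd y) = c (snd (\<psi> (u, t)))"
    for x y u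
    using opG_hom[of x y t] \<phi>_colour[OF in_Z[OF that(3)] that(1)] that t by simp
  show ?thesis unfolding rect_band_def
  proof (intro conjI ballI)
    fix u v assume uv: "u \<in> pverts G" "v \<in> pverts G"
    have "\<phi> (mix (\<psi> (u, t)) (\<psi> (v, t))) \<in> Z" using in_Z uv by simp
    then show "opG t u v \<in> pverts G" unfolding opG_def Z_iff by blast
    show "opG t u u = u" unfolding opG_def by simp
    fix w assume w: "w \<in> pverts G"
    have "opG t (opG t u v) w = opG t (fst (\<phi> (mix (\<psi> (u, t)) (\<psi> (v, t))))) (fst (\<phi> (\<psi> (w, t))))"
      unfolding opG_def[of t u v] by simp
    also have "\<dots> = fst (\<phi> (mix (mix (\<psi> (u, t)) (\<psi> (v, t))) (\<psi> (w, t))))"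
      by (rule hom[OF _ _ uv(1)]) (use uv w in \<open>simp_all add: pair_in_Z t col[of w u] col[of v u]\<close>)
    also have "\<dots> = opG t u w" unfolding opG_def by simp
    finally show "opG t (opG t u v) w = opG t u w" .
    have "opG t u (opG t v w) = opG t (fst (\<phi> (\<psi> (u, t)))) (fst (\<phi> (mix (\<psi> (v, t)) (\<psi> (w, t)))))"
      unfolding opG_def[of t v w] by simp
    also have "\<dots> = fst (\<phi> (mix (\<psi> (u, t)) (mix (\<psi> (v, t)) (\<psi> (w, t)))))"
      by (rule hom[OF _ _ uv(1)]) (use uv w in \<open>simp_all add: pair_in_Z t col[of w u] col[of v u]\<close>)
    also have "\<dots> = opG t u w" unfolding opG_def by simp
    finally show "opG t u (opG t v w) = opG t u w" .
  qed
qed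

lemma opG_arc:
  assumes st: "(s, t) \<in> parcs H" and "(u1, w1) \<in> parcs G" "(u2, w2) \<in> parcs G"
  shows "(opG s u1 u2, opG t w1 w2) \<in> parcs G"
proof -
  have "(\<psi> (u1, s), \<psi> (w1, t)) \<in> prod_arcs" "(\<psi> (u2, s), \<psi> (w2, t)) \<in> prod_arcs"
    by (rule \<psi>_arc; simp add: arcs_iff assms)+
  then have "(mix (\<psi> (u1, s)) (\<psi> (u2, s)), mix (\<psi> (w1, t)) (\<psi> (w2, t))) \<in> prod_arcs"
    by (simp add: arcs_iff)
  from \<phi>_arc[OF this] show ?thesis unfolding opG_def arcs_iff by blast
qed

text \<open>Here factor-looplessness enters. \<open>s\<close> and \<open>t\<close> have different
  colours, so \<open>opG s\<close> and \<open>opG t\<close> form a decomposition of the relation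
  \<open>G\<close> that might treat its rows and columns differently.\<close>

lemma opG_eq_adjacent:
  assumes st: "(s, t) \<in> parcs H" and "u \<in> pverts G" "v \<in> pverts G"
  shows "opG s u v = opG t u v"
proof (rule factor_loopless_self_dual[OF graphs(1) loopless thin_birelation_G[OF twin_free(1)] _ assms(2,3)])
  show "decomposition_op (pverts G) (pverts G) (\<lambda>u v. (u, v) \<in> parcs G) (opG s) (opG t)"
    using rect_band_opG arc_H[OF st] opG_arc[OF st] unfolding decomposition_op_def by blast
qed

definition s0 :: 'b where "s0 = (SOME s. s \<in> pverts H)"

definition v0 :: 'a where "v0 = (SOME v. v \<in> pverts G)"

lemma s0: "s0 \<in> pverts H" and v0: "v0 \<in> pverts G"
  using arcs_G arcs_H arc_G arc_H unfolding s0_def v0_def by (metis equals0I someI surj_pair)+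

abbreviation opG0 :: "'a \<Rightarrow> 'a \<Rightarrow> 'a" where "opG0 \<equiv> opG s0"

lemmas opG0 = rect_bandD[OF rect_band_opG[OF s0]]

text \<open>\<open>s0\<close> answers for its own colour, and a neighbour of \<open>s0\<close>,
  whose operation is the same, for the other one.\<close>

lemma opG0_hom:
  assumes "x \<in> Z" "y \<in> Z" "c (snd x) = c (snd y)"
  shows "fst (\<phi> (mix x y)) = opG0 (fst (\<phi> x)) (fst (\<phi> y))"
proof (cases "c s0 = c (snd (\<phi> x))")
  case True
  then show ?thesis using opG_hom[OF assms s0] by blast
next
  case False
  obtain t where t: "(s0, t) \<in> parcs H" using nbr_H s0 by blast
  then have "c t = c (snd (\<phi> x))" using colour[OF t] False by auto
  then have "fst (\<phi> (mix x y)) = opG t (fst (\<phi> x)) (fst (\<phi> y))"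
    using opG_hom[OF assms] arc_H[OF t] by blast
  also have "\<dots> = opG0 (fst (\<phi> x)) (fst (\<phi> y))"
    using opG_eq_adjacent[OF t] \<phi>_in assms Z_iff by metis
  finally show ?thesis .
qed

lemma opG0_arc:
  assumes "(u1, w1) \<in> parcs G" "(u2, w2) \<in> parcs G"
  shows "(opG0 u1 u2, opG0 w1 w2) \<in> parcs G"
proof -
  obtain t where t: "(s0, t) \<in> parcs H" using nbr_H s0 by blast
  show ?thesis
    using opG_arc[OF t assms] opG_eq_adjacent[OF t, of w1 w2] arc_G assms by simp
qed

lemma decomposition_opG0:
  "decomposition_op (pverts G) (pverts G) (\<lambda>u v. (u, v) \<in> parcs G) opG0 opG0"
  using rect_band_opG[OF s0] opG0_arc unfolding decomposition_op_def by blast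

section \<open>The exchanged part of the second factor\<close>

definition opH :: "'b \<Rightarrow> 'b \<Rightarrow> 'b" where
  "opH s t = snd (mix\<phi> (v0, s) (v0, t))"

lemma v0_in: "s \<in> pverts H \<Longrightarrow> (v0, s) \<in> Z" using v0 by (simp add: Z_iff)

text \<open>Overwriting both first coordinates by \<open>v0\<close> is an application of
  \<open>mix\<close>, which commutes with \<open>mix\<phi>\<close>; the second coordinate of the
  result is unaffected.\<close>

lemma opH_hom:
  assumes "x \<in> Z" "y \<in> Z" "c (snd x) = c (snd y)"
  shows "snd (mix\<phi> x y) = opH (snd x) (snd y)"
proof -
  let ?o = "(v0, snd x)"
  have o: "?o \<in> Z" using v0_in assms Z_iff by blast
  have "mix\<phi> (mix ?o x) (mix ?o y) = mix (mix\<phi> ?o ?o) (mix\<phi> x y)"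
    by (rule mix_commute) (use assms o in simp_all)
  then have "mix\<phi> (v0, snd x) (v0, snd y) = mix ?o (mix\<phi> x y)" by (simp add: mix_def)
  then show ?thesis unfolding opH_def by simp
qed

lemma opH_in:
  assumes "s \<in> pverts H" "t \<in> pverts H"
  shows "opH s t \<in> pverts H" "c (opH s t) = c t"
  using mix\<phi>_in[of "(v0, s)" "(v0, t)"] mix\<phi>_colour[of "(v0, s)" "(v0, t)"] v0_in assms
  unfolding opH_def Z_iff[of "mix\<phi> _ _"] by auto

lemma opH_idem: "opH s s = s" unfolding opH_def by simp

text \<open>\<open>opH\<close> is a rectangular band on each colour class separately, since
  \<open>mix_commute\<close> compares points of one class only.\<close>

lemma opH_assoc:
  assumes "r \<in> pverts H" "s \<in> pverts H" "t \<in> pverts H" "c r = c s" "c s = c t"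
  shows "opH (opH r s) t = opH r t" "opH r (opH s t) = opH r t"
proof -
  note Z = v0_in[OF assms(1)] v0_in[OF assms(2)] v0_in[OF assms(3)]
  have "opH r t = snd (mix\<phi> (mix\<phi> (v0, r) (v0, s)) (v0, t))" unfolding opH_def by simp
  also have "\<dots> = opH (opH r s) t"
    by (subst opH_hom) (use Z assms mix\<phi>_colour[OF Z(1,2)] in \<open>auto simp: opH_def\<close>)
  finally show "opH (opH r s) t = opH r t" ..
  have "opH r t = snd (mix\<phi> (v0, r) (mix\<phi> (v0, s) (v0, t)))" unfolding opH_def by simp
  also have "\<dots> = opH r (opH s t)"
    by (subst opH_hom) (use Z assms mix\<phi>_colour[OF Z(2,3)] in \<open>auto simp: opH_def\<close>)
  finally show "opH r (opH s t) = opH r t" ..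
qed

lemma opH_arc:
  assumes "(p1, q1) \<in> parcs H" "(p2, q2) \<in> parcs H" "c p1 = c p2"
  shows "(opH p1 p2, opH q1 q2) \<in> parcs H"
proof -
  obtain w where w: "(v0, w) \<in> parcs G" using nbr_G v0 by blast
  have arc: "((v0, p1), (w, q1)) \<in> prod_arcs" "((v0, p2), (w, q2)) \<in> prod_arcs"
    using w assms by (simp_all add: arcs_iff)
  note Z = product_arc(1,2)[OF arc(1)] product_arc(1,2)[OF arc(2)]
  have cq: "c q1 = c q2" using colour assms by blast
  have "(mix\<phi> (v0, p1) (v0, p2), mix\<phi> (w, q1) (w, q2)) \<in> prod_arcs"
    by (rule decomposition_opD(3)[OF decomposition_mix\<phi>[of "c p1"]])
      (use Z cq assms arc colour in \<open>auto simp only: part_iff snd_conv\<close>)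
  then have "(snd (mix\<phi> (v0, p1) (v0, p2)), snd (mix\<phi> (w, q1) (w, q2))) \<in> parcs H"
    unfolding arcs_iff by blast
  then show ?thesis using opH_hom Z assms(3) cq by simp
qed

section \<open>The common factor of the two graphs\<close>

definition base :: "'b \<Rightarrow> 'b" where
  "base s = (if c s = c s0 then s0 else SOME t. (s0, t) \<in> parcs H)"

lemma base: "base s \<in> pverts H" "c (base s) = c s"
proof -
  have t: "(s0, SOME t. (s0, t) \<in> parcs H) \<in> parcs H" using nbr_H[OF s0] by (rule someI_ex)
  show "base s \<in> pverts H" "c (base s) = c s"
    using s0 arc_H(2)[OF t] colour[OF t] unfolding base_def by auto
qed

lemma base_cong: "c s = c t \<Longrightarrow> base s = base t"
  unfolding base_def by simp

text \<open>The projection of \<open>H\<close> to its part that is not exchanged. The other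
  coordinate is reset to a base point of the same colour, because \<open>opH\<close> combines
  vertices of one class. Likewise \<open>\<delta>\<close> projects \<open>G\<close> to its exchanged
  part.\<close>

definition \<sigma> :: "'b \<Rightarrow> 'b" where "\<sigma> s = opH (base s) s"

definition \<delta> :: "'a \<Rightarrow> 'a" where "\<delta> v = opG0 v0 v"

text \<open>What a vertex of \<open>H\<close> contributes to the first coordinate after
  \<open>\<phi>\<close>, measured over the fixed vertex \<open>v0\<close>.\<close>

definition \<gamma> :: "'b \<Rightarrow> 'a" where "\<gamma> s = fst (\<phi> (v0, s))"

lemma \<gamma>_in: "s \<in> pverts H \<Longrightarrow> \<gamma> s \<in> pverts G"
  using \<phi>_in v0_in Z_iff unfolding \<gamma>_def by blast

lemma \<sigma>_colour: "s \<in> pverts H \<Longrightarrow> c (\<sigma> s) = c s"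
  unfolding \<sigma>_def using opH_in base by blast

lemma \<sigma>_eqD:
  assumes "s \<in> pverts H" "t \<in> pverts H" "\<sigma> s = \<sigma> t"
  shows "c s = c t" "opH s t = s"
proof -
  show c: "c s = c t" using \<sigma>_colour assms by metis
  note b = base[of t]
  have "opH s t = opH s (opH (base t) t)" using opH_assoc(2)[of s "base t" t] assms b c by simp
  also have "\<dots> = opH s (opH (base s) s)" using assms(3) unfolding \<sigma>_def by simp
  also have "\<dots> = s" using opH_assoc(2)[of s "base s" s] assms base[of s] opH_idem by simp
  finally show "opH s t = s" .
qed

lemma \<sigma>_opH:
  assumes "s \<in> pverts H" "t \<in> pverts H" "c s = c t" shows "\<sigma> (opH s t) = \<sigma> t"
proof -
  have "base (opH s t) = base t" using base_cong opH_in assms by blast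
  then show ?thesis unfolding \<sigma>_def using opH_assoc(2)[of "base t" s t] assms base[of t] by simp
qed

lemma \<delta>_opG: "u \<in> pverts G \<Longrightarrow> v \<in> pverts G \<Longrightarrow> \<delta> (opG0 u v) = \<delta> v"
  unfolding \<delta>_def using opG0 v0 by simp

lemma opG_\<delta>: "u \<in> pverts G \<Longrightarrow> v \<in> pverts G \<Longrightarrow> opG0 u (\<delta> v) = opG0 u v"
  unfolding \<delta>_def using opG0 v0 by simp

lemma \<delta>_eqD:
  assumes "u \<in> pverts G" "v \<in> pverts G" "\<delta> u = \<delta> v" shows "opG0 u v = u"
  using opG_\<delta>[OF assms(1,2)] opG_\<delta>[OF assms(1,1)] assms(3) opG0(2)[OF assms(1)] by simp

lemma \<gamma>_snd:
  assumes "x \<in> Z" "s \<in> pverts H" "c s = c (snd x)"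
  shows "\<gamma> (snd x) = opG0 (\<gamma> s) (fst (\<phi> x))"
proof -
  have "mix (v0, s) x = (v0, snd x)" unfolding mix_def by simp
  then show ?thesis using opG0_hom[of "(v0, s)" x] assms v0_in unfolding \<gamma>_def by simp
qed

text \<open>The exchanged part of the first coordinate of \<open>\<phi> x\<close> comes from
  \<open>snd x\<close> alone, whatever \<open>fst x\<close> is.\<close>

lemma \<delta>_\<gamma>_snd:
  assumes "x \<in> Z" shows "\<delta> (\<gamma> (snd x)) = \<delta> (fst (\<phi> x))"
proof -
  have V: "snd x \<in> pverts H" "fst (\<phi> x) \<in> pverts G" using assms \<phi>_in Z_iff by blast+
  have "\<gamma> (snd x) = opG0 (\<gamma> (snd x)) (fst (\<phi> x))" using \<gamma>_snd[OF assms V(1)] by simp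
  then show ?thesis using \<delta>_opG[OF \<gamma>_in[OF V(1)] V(2)] by simp
qed

text \<open>A vertex \<open>s\<close> of \<open>H\<close> is recovered from its unexchanged part
  \<open>\<sigma> s\<close> and its exchanged part, which \<open>\<phi>\<close> displays inside
  \<open>G\<close> as \<open>\<delta> (\<gamma> s)\<close>. Thus the image of
  \<open>\<delta>\<close>, a factor of \<open>G\<close>, is a factor of \<open>H\<close>
  too.\<close>

lemma common_factor:
  "graph_iso_map H (image_graph \<sigma> H \<times>\<^sub>g image_graph \<delta> G) (\<lambda>s. (\<sigma> s, \<delta> (\<gamma> s)))"
  unfolding graph_iso_map_def pverts_direct_product parcs_direct_product image_graph_simps
proof (intro conjI ballI)
  \<comment> \<open>\<open>mix\<phi>\<close> uses only the first coordinate after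
    \<open>\<phi>\<close> of its first argument, so \<open>opH s t\<close> depends on
    \<open>s\<close> through \<open>\<gamma> s\<close>.\<close>
  have opH_cong: "opH s' t = opH s t"
    if "s \<in> pverts H" "s' \<in> pverts H" "t \<in> pverts H" "c s = c s'" "c s' = c t" "\<gamma> s = \<gamma> s'" for s s' t
    using that unfolding opH_def mix\<phi>_def \<gamma>_def mix_def by simp
  show "bij_betw (\<lambda>s. (\<sigma> s, \<delta> (\<gamma> s))) (pverts H) (\<sigma> ` pverts H \<times> \<delta> ` pverts G)"
    unfolding bij_betw_def
  proof (intro conjI equalityI subsetI)
    show "inj_on (\<lambda>s. (\<sigma> s, \<delta> (\<gamma> s))) (pverts H)"
    proof (rule inj_onI)
      fix s t assume st: "s \<in> pverts H" "t \<in> pverts H" "(\<sigma> s, \<delta> (\<gamma> s)) = (\<sigma> t, \<delta> (\<gamma> t))"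
      then have s: "c s = c t" "opH s t = s" using \<sigma>_eqD[of s t] by auto
      have "\<gamma> t = opG0 (\<gamma> s) (\<gamma> t)"
        using \<gamma>_snd[OF v0_in[OF st(2)] st(1)] s unfolding \<gamma>_def by simp
      also have "\<dots> = \<gamma> s" using \<delta>_eqD[OF \<gamma>_in \<gamma>_in] st by simp
      finally have "opH s t = opH t t" using opH_cong[of t s t] st s by simp
      then show "s = t" using s opH_idem by simp
    qed
    fix p assume "p \<in> \<sigma> ` pverts H \<times> \<delta> ` pverts G"
    then obtain s v where p: "p = (\<sigma> s, \<delta> v)" "s \<in> pverts H" "v \<in> pverts G" by auto
    have vs: "(v0, s) \<in> Z" using p v0_in by blast
    then have t: "snd (\<phi> (v0, s)) \<in> pverts H" using \<phi>_in Z_iff by blast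
    let ?y = "\<psi> (v, snd (\<phi> (v0, s)))"
    have y: "?y \<in> Z" using t p by (simp add: pair_in_Z)
    have cy: "c (snd ?y) = c s" using \<phi>_colour[OF y vs] by simp
    \<comment> \<open>This is \<open>?y\<close> again, since \<open>\<phi> ?y\<close> already has
      the second coordinate of \<open>\<phi> (v0, s)\<close>. The form exposes \<open>snd ?x\<close>
      as a value of \<open>opH\<close>.\<close>
    let ?x = "mix\<phi> ?y (v0, s)"
    have x: "?x \<in> Z" using y vs mix\<phi>_in by blast
    have sy: "snd ?y \<in> pverts H" using y Z_iff by blast
    have "snd ?x = opH (snd ?y) s" using opH_hom[OF y vs] cy by simp
    then have "\<sigma> (snd ?x) = \<sigma> s" using \<sigma>_opH[OF sy p(2) cy] by simp
    moreover have "\<delta> (\<gamma> (snd ?x)) = \<delta> v" using \<delta>_\<gamma>_snd[OF x] by simp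
    ultimately have "p = (\<sigma> (snd ?x), \<delta> (\<gamma> (snd ?x)))" using p(1) by simp
    moreover have "snd ?x \<in> pverts H" using x Z_iff by blast
    ultimately show "p \<in> (\<lambda>s. (\<sigma> s, \<delta> (\<gamma> s))) ` pverts H" by (rule image_eqI)
  qed (use \<gamma>_in in auto)
  fix p q assume pq: "p \<in> pverts H" "q \<in> pverts H"
  show "(\<sigma> p, \<sigma> q) \<in> map_prod \<sigma> \<sigma> ` parcs H \<and>
      (\<delta> (\<gamma> p), \<delta> (\<gamma> q)) \<in> map_prod \<delta> \<delta> ` parcs G \<longleftrightarrow> (p, q) \<in> parcs H" (is "?L \<longleftrightarrow> _")
  proof
    assume L: ?L
    then obtain p1 q1 where 1: "(p1, q1) \<in> parcs H" "\<sigma> p = \<sigma> p1" "\<sigma> q = \<sigma> q1" by auto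
    from L obtain v w where 2: "(v, w) \<in> parcs G" "\<delta> (\<gamma> p) = \<delta> v" "\<delta> (\<gamma> q) = \<delta> w" by auto
    note V = arc_H[OF 1(1)] arc_G[OF 2(1)]
    note p1 = \<sigma>_eqD[OF pq(1) V(1) 1(2)] and q1 = \<sigma>_eqD[OF pq(2) V(2) 1(3)]
    have "snd (\<phi> (v0, p)) \<in> pverts H" using \<phi>_in v0_in pq Z_iff by blast
    then obtain t1 where t1: "(snd (\<phi> (v0, p)), t1) \<in> parcs H" using nbr_H by blast
    \<comment> \<open>Realizes the arc \<open>(v, w)\<close> in the product. \<open>snd ?e\<close>
      and \<open>snd ?f\<close> are adjacent and have the \<open>\<gamma>\<close>-values of
      \<open>p\<close> and \<open>q\<close>, so they may replace the first arguments in
      \<open>opH p p1 = p\<close> and \<open>opH q q1 = q\<close>.\<close>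
    let ?e = "\<psi> (v, snd (\<phi> (v0, p)))" and ?f = "\<psi> (w, t1)"
    have arc: "(?e, ?f) \<in> prod_arcs" by (rule \<psi>_arc) (use t1 2 in \<open>simp add: arcs_iff\<close>)
    note ef = product_arc(1,2,4)[OF arc]
    have snd_ef: "snd ?e \<in> pverts H" "snd ?f \<in> pverts H" using ef Z_iff by blast+
    have ce: "c p = c (snd ?e)" using \<phi>_colour[OF ef(1) v0_in[OF pq(1)]] by simp
    have cf: "c q = c (snd ?f)" using ce ef(3) p1(1) q1(1) colour[OF 1(1)] by auto
    have "\<gamma> (snd ?e) = \<gamma> p"
      using \<gamma>_snd[OF ef(1) pq(1) ce] \<delta>_eqD[OF \<gamma>_in[OF pq(1)] V(3) 2(2)] by simp
    then have "opH (snd ?e) p1 = p"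
      using opH_cong[of p "snd ?e" p1] pq V snd_ef ce p1 by simp
    moreover have "\<gamma> (snd ?f) = \<gamma> q"
      using \<gamma>_snd[OF ef(2) pq(2) cf] \<delta>_eqD[OF \<gamma>_in[OF pq(2)] V(4) 2(3)] by simp
    then have "opH (snd ?f) q1 = q"
      using opH_cong[of q "snd ?f" q1] pq V snd_ef cf q1 by simp
    moreover have "(opH (snd ?e) p1, opH (snd ?f) q1) \<in> parcs H"
      by (rule opH_arc) (use arc 1 ce p1 in \<open>simp_all add: arcs_iff\<close>)
    ultimately show "(p, q) \<in> parcs H" by simp
  next
    assume arc: "(p, q) \<in> parcs H"
    obtain w where w: "(v0, w) \<in> parcs G" using nbr_G v0 by blast
    have A: "((v0, p), (w, q)) \<in> prod_arcs" using arc w by (simp add: arcs_iff)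
    have "(\<gamma> p, fst (\<phi> (w, q))) \<in> parcs G" using \<phi>_arc[OF A] unfolding \<gamma>_def arcs_iff by blast
    moreover have "\<delta> (\<gamma> q) = \<delta> (fst (\<phi> (w, q)))"
      using \<delta>_\<gamma>_snd[OF product_arc(2)[OF A]] by simp
    ultimately show ?L using arc by (auto simp: rev_image_eqI)
  qed
qed

text \<open>The image of \<open>\<delta>\<close> divides \<open>G\<close> by \<open>opG0\<close> and
  \<open>H\<close> by \<open>common_factor\<close>. Coprimality leaves it at most one vertex, so
  \<open>\<delta>\<close> is constant.\<close>

lemma coprime_opG:
  assumes "graph_coprime G H" and uv: "u \<in> pverts G" "v \<in> pverts G"
  shows "opG0 u v = u"
proof -
  let ?F = "image_graph (\<lambda>x. opG0 x v0) G" and ?D = "image_graph \<delta> G" and ?S = "image_graph \<sigma> H"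
  note pg = pseudo_graph_image_graph[OF graphs(1)] pseudo_graph_image_graph[OF graphs(2)]
  have D: "graph_iso_map G (?F \<times>\<^sub>g ?D) (\<lambda>x. (opG0 x v0, \<delta> x))"
    unfolding \<delta>_def[abs_def] by (rule graph_iso_map_decomposition[OF graphs(1) decomposition_opG0 v0])
  obtain F' :: "nat pair_pre_digraph" and f where F': "pair_pseudo_graph F'" "graph_iso_map ?F F' f"
    using nat_copy[OF pg(1)] by blast
  obtain D' :: "nat pair_pre_digraph" and d where D': "pair_pseudo_graph D'" "graph_iso_map ?D D' d"
    using nat_copy[OF pg(1)] by blast
  obtain S' :: "nat pair_pre_digraph" and s where S': "pair_pseudo_graph S'" "graph_iso_map ?S S' s"
    using nat_copy[OF pg(2)] by blast
  have "digraph_iso (with_proj G) (with_proj (F' \<times>\<^sub>g D'))"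
    using graph_iso_map_comp[OF D graph_iso_map_product[OF F'(2) D'(2)]]
      digraph_iso_iff_graph_iso_map[OF pseudo_graph_wf[OF graphs(1)]
        pseudo_graph_wf[OF pseudo_graph_direct_product[OF F'(1) D'(1)]]] by blast
  moreover have "digraph_iso (with_proj H) (with_proj (S' \<times>\<^sub>g D'))"
    using graph_iso_map_comp[OF common_factor graph_iso_map_product[OF S'(2) D'(2)]]
      digraph_iso_iff_graph_iso_map[OF pseudo_graph_wf[OF graphs(2)]
        pseudo_graph_wf[OF pseudo_graph_direct_product[OF S'(1) D'(1)]]] by blast
  ultimately have "\<not> card (pverts D') > 1"
    using assms(1) F'(1) D'(1) S'(1) unfolding graph_coprime_def by blast
  moreover have "card (pverts ?D) = card (pverts D')"
    using D'(2) bij_betw_same_card unfolding graph_iso_map_def by blast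
  ultimately have "card (\<delta> ` pverts G) \<le> Suc 0" unfolding image_graph_simps by simp
  then have "\<delta> u = \<delta> v"
    using card_le_Suc0_iff_eq[of "\<delta> ` pverts G"] uv graphs(1) unfolding pseudo_graph_iff by blast
  then show ?thesis by (rule \<delta>_eqD[OF uv])
qed

text \<open>With a trivial exchanged part, \<open>mix x y\<close> and \<open>x\<close> have images
  with the same first coordinate. So the second coordinate influences it through its colour at most,
  as \<open>mix\<close> is controlled within one class.\<close>

lemma coordinates_preserved:
  assumes cop: "graph_coprime G H"
  obtains \<alpha> g where "\<And>u s. u \<in> pverts G \<Longrightarrow> s \<in> pverts H \<Longrightarrow> \<phi> (u, s) = (\<alpha> (c s) u, g s)"
    and "\<And>b. bij_betw (\<alpha> b) (pverts G) (pverts G)"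
proof -
  define bs where "bs b = (SOME s. s \<in> pverts H \<and> c s = b)" for b
  have bs: "bs b \<in> pverts H" "c (bs b) = b" for b
  proof -
    have "\<exists>s. s \<in> pverts H \<and> c s = b" using colour_nonempty[of b] arc_H by blast
    from someI_ex[OF this] show "bs b \<in> pverts H" "c (bs b) = b" unfolding bs_def by blast+
  qed
  define \<alpha> where "\<alpha> b u = fst (\<phi> (u, bs b))" for b u
  have fst_mix: "fst (\<phi> (mix x y)) = fst (\<phi> x)" if "x \<in> Z" "y \<in> Z" "c (snd x) = c (snd y)" for x y
  proof -
    have "fst (\<phi> x) \<in> pverts G" "fst (\<phi> y) \<in> pverts G" using that \<phi>_in Z_iff by blast+
    then show ?thesis using opG0_hom[OF that] coprime_opG[OF cop] by simp
  qed
  have fst_\<phi>: "fst (\<phi> (u, s)) = \<alpha> (c s) u" if "u \<in> pverts G" "s \<in> pverts H" for u s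
  proof -
    have "mix (u, bs (c s)) (u, s) = (u, s)" unfolding mix_def by simp
    then show ?thesis unfolding \<alpha>_def
      using fst_mix[of "(u, bs (c s))" "(u, s)"] that bs by (simp add: pair_in_Z)
  qed
  have \<alpha>_in: "\<alpha> b u \<in> pverts G" if "u \<in> pverts G" for b u
    unfolding \<alpha>_def using \<phi>_in[of "(u, bs b)"] that bs[of b] Z_iff pair_in_Z by blast
  have "v \<in> \<alpha> b ` pverts G" if v: "v \<in> pverts G" for b v
  proof -
    let ?t = "snd (\<phi> (v0, bs b))"
    have o: "(v0, bs b) \<in> Z" using v0_in bs by blast
    then have t: "?t \<in> pverts H" using \<phi>_in Z_iff by blast
    then have y: "\<psi> (v, ?t) \<in> Z" using v by (simp add: pair_in_Z)
    then have y': "fst (\<psi> (v, ?t)) \<in> pverts G" "snd (\<psi> (v, ?t)) \<in> pverts H" using Z_iff by blast+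
    have "c (snd (\<psi> (v, ?t))) = b" using \<phi>_colour[OF y o] bs by simp
    then have "\<alpha> b (fst (\<psi> (v, ?t))) = v" using fst_\<phi>[OF y'] by simp
    then show ?thesis using y'(1) by (metis imageI)
  qed
  then have surj: "\<alpha> b ` pverts G = pverts G" for b
    using \<alpha>_in by (intro equalityI image_subsetI subsetI)
  have fin: "finite (pverts G)" using graphs unfolding pseudo_graph_iff by blast
  have inj: "inj_on (\<alpha> b) (pverts G)" for b by (rule eq_card_imp_inj_on[OF fin]) (simp add: surj)
  have "snd (\<phi> (u, s)) = snd (\<phi> (v0, s))" if us: "u \<in> pverts G" "s \<in> pverts H" for u s
  proof -
    let ?x = "(u, s)" and ?y = "(v0, s)"
    have xy: "?x \<in> Z" "?y \<in> Z" using us v0 by (simp_all add: pair_in_Z)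
    \<comment> \<open>After \<open>\<phi>\<close> this point has the first coordinate of
      \<open>?x\<close> and the second of \<open>?y\<close>. Injectivity of \<open>\<alpha>\<close>
      and idempotence of \<open>opH\<close> show that it is \<open>?x\<close> itself.\<close>
    let ?m = "mix\<phi> ?x ?y"
    have m: "?m \<in> Z" using xy by (rule mix\<phi>_in)
    have cm: "c (snd ?m) = c s" using mix\<phi>_colour[OF xy] by simp
    have m': "fst ?m \<in> pverts G" "snd ?m \<in> pverts H" using m Z_iff by blast+
    have "\<alpha> (c s) (fst ?m) = fst (\<phi> ?m)" using fst_\<phi>[OF m'] cm by simp
    also have "\<dots> = \<alpha> (c s) u" using fst_\<phi>[OF us] by simp
    finally have "fst ?m = u" using inj m' us by (meson inj_onD)
    moreover have "snd ?m = s" using opH_hom[OF xy] opH_idem by simp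
    ultimately have "?m = ?x" by (simp add: prod_eq_iff)
    then have "snd (\<phi> ?x) = snd (\<phi> ?m)" by simp
    then show ?thesis by simp
  qed
  then have "\<phi> (u, s) = (\<alpha> (c s) u, snd (\<phi> (v0, s)))" if "u \<in> pverts G" "s \<in> pverts H" for u s
    using fst_\<phi>[OF that] that by (simp add: prod_eq_iff)
  moreover have "bij_betw (\<alpha> b) (pverts G) (pverts G)" for b
    using surj inj unfolding bij_betw_def by blast
  ultimately show ?thesis by (rule that)
qed

end

section \<open>Stability and two-fold automorphisms\<close>

lemma pverts_K2: "pverts K2 = UNIV" and parcs_K2: "(a, b) \<in> parcs K2 \<longleftrightarrow> a \<noteq> b"
  unfolding K2_def by auto

lemma (in coloured_pair) coloured_pair_K2: "coloured_pair G K2 id"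
proof (rule coloured_pair.intro)
  show "pair_pseudo_graph K2" unfolding pseudo_graph_iff by (auto simp: pverts_K2 parcs_K2 sym_def)
  show "(s, t) \<in> (parcs K2)\<^sup>*" for s t
    by (cases "s = t") (auto simp: parcs_K2)
  show "parcs K2 \<noteq> {}" using parcs_K2[of True False] by blast
qed (use graphs even_walk arcs_G in \<open>auto simp: parcs_K2\<close>)

text \<open>An automorphism of the product with \<open>K2\<close> moves whole colour classes, hence
  is a two-fold automorphism of \<open>G\<close> together with a permutation of \<open>K2\<close>.
  It is componentwise exactly when its two permutations agree on \<open>G\<close>.\<close>

lemma (in coloured_pair) stable_graph_iff:
  "stable_graph G \<longleftrightarrow>
     (\<forall>\<alpha>. (\<forall>b. bij_betw (\<alpha> b) (pverts G) (pverts G)) \<longrightarrow>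
       (\<forall>b. \<forall>u\<in>pverts G. \<forall>v\<in>pverts G. (\<alpha> b u, \<alpha> (\<not> b) v) \<in> parcs G \<longleftrightarrow> (u, v) \<in> parcs G) \<longrightarrow>
       (\<forall>u\<in>pverts G. \<alpha> True u = \<alpha> False u))"
    (is "_ \<longleftrightarrow> (\<forall>\<alpha>. ?bij \<alpha> \<longrightarrow> ?adj \<alpha> \<longrightarrow> ?eq \<alpha>)")
proof (intro iffI allI impI)
  interpret K: coloured_pair G K2 id by (rule coloured_pair_K2)
  fix \<alpha> assume st: "stable_graph G" and \<alpha>: "?bij \<alpha>" "?adj \<alpha>"
  define \<chi> where "\<chi> = (\<lambda>p. if p \<in> pverts (G \<times>\<^sub>g K2) then (\<alpha> (id (snd p)) (fst p), snd p) else p)"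
  have "\<chi> \<in> automorphisms (G \<times>\<^sub>g K2)"
    unfolding \<chi>_def by (rule K.twist_automorphism) (use \<alpha> in blast)+
  then obtain f g where eq: "\<chi> = componentwise G K2 f g"
    using st unfolding stable_graph_def stable_pair_iff by blast
  have "\<alpha> b u = f u" if "u \<in> pverts G" for u b
    using fun_cong[OF eq, of "(u, b)"] that
    unfolding \<chi>_def componentwise_def by (simp add: pverts_direct_product pverts_K2)
  then show "?eq \<alpha>" by simp
next
  interpret K: coloured_pair G K2 id by (rule coloured_pair_K2)
  assume tf: "\<forall>\<alpha>. ?bij \<alpha> \<longrightarrow> ?adj \<alpha> \<longrightarrow> ?eq \<alpha>"
  show "stable_graph G" unfolding stable_graph_def stable_pair_iff
  proof
    fix \<chi> assume \<chi>: "\<chi> \<in> automorphisms (G \<times>\<^sub>g K2)"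
    note perm = automorphismsD(1)[OF \<chi>]
    obtain w where w: "w \<in> pverts G" using arcs_G arc_G by auto
    define h where "h b = snd (\<chi> (w, b))" for b
    define \<alpha> where "\<alpha> b u = fst (\<chi> (u, b))" for b u
    have snd: "snd (\<chi> (u, b)) = h b" if "u \<in> pverts G" for u b
      using K.automorphism_colour[OF \<chi>, of "(u, b)" "(w, b)"] that w
      unfolding h_def by (simp add: pverts_direct_product pverts_K2)
    have h: "h False \<noteq> h True"
      using K.automorphism_colour[OF \<chi>, of "(w, False)" "(w, True)"] w
      unfolding h_def by (simp add: pverts_direct_product pverts_K2)
    have \<chi>_eq: "\<chi> (u, b) = (\<alpha> b u, h b)" if "u \<in> pverts G" for u b
      using snd[OF that] by (simp add: \<alpha>_def prod_eq_iff)
    have in_G: "\<alpha> b u \<in> pverts G" if "u \<in> pverts G" for u b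
      using permutes_in_image[OF perm, of "(u, b)"] that
      by (simp add: \<chi>_eq pverts_direct_product pverts_K2)
    have inj: "inj_on (\<alpha> b) (pverts G)" for b
    proof (rule inj_onI)
      fix u v assume "u \<in> pverts G" "v \<in> pverts G" "\<alpha> b u = \<alpha> b v"
      then have "\<chi> (u, b) = \<chi> (v, b)" by (simp add: \<chi>_eq)
      then show "u = v" using injD[OF permutes_inj[OF perm]] by blast
    qed
    have "finite (pverts G)" using graphs unfolding pseudo_graph_iff by blast
    from endo_inj_surj[OF this _ inj]
    have bij: "bij_betw (\<alpha> b) (pverts G) (pverts G)" for b
      unfolding bij_betw_def using inj in_G by blast
    have hh: "h b \<noteq> h (\<not> b)" for b using h by (cases b) auto
    have adj: "(\<alpha> b u, \<alpha> (\<not> b) v) \<in> parcs G \<longleftrightarrow> (u, v) \<in> parcs G"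
      if "u \<in> pverts G" "v \<in> pverts G" for b u v
      using automorphismsD(2)[OF \<chi>, of "(u, b)" "(v, \<not> b)"] that hh
      by (simp add: \<chi>_eq pverts_direct_product parcs_direct_product pverts_K2 parcs_K2)
    have "\<alpha> True u = \<alpha> False u" if "u \<in> pverts G" for u
      using tf[rule_format, of \<alpha>, OF bij adj that] by blast
    note same = this
    define f where "f u = (if u \<in> pverts G then \<alpha> True u else u)" for u
    have \<alpha>_eq: "\<alpha> b u = f u" if "u \<in> pverts G" for b u
      using same[OF that] that by (cases b) (auto simp: f_def)
    have "bij_betw f (pverts G) (pverts G)"
      by (subst bij_betw_cong[where g = "\<alpha> True"]) (auto simp: f_def bij)
    then have "f permutes pverts G" by (rule bij_imp_permutes) (simp add: f_def)
    then have "f \<in> automorphisms G"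
      using adj[of _ _ True] \<alpha>_eq unfolding automorphisms_def by simp
    moreover have "h permutes UNIV" 
      by (rule bij_imp_permutes)
        (use h in \<open>auto simp: bij_betw_def inj_on_def UNIV_bool image_iff split: if_splits\<close>)
    then have "h \<in> automorphisms K2"
      using h unfolding automorphisms_def by (auto simp: pverts_K2 parcs_K2) (metis (full_types))+
    moreover have "\<chi> = componentwise G K2 f h"
    proof
      fix p show "\<chi> p = componentwise G K2 f h p"
      proof (cases "p \<in> pverts (G \<times>\<^sub>g K2)")
        case True
        then obtain u b where "p = (u, b)" "u \<in> pverts G" by (auto simp: pverts_direct_product)
        then show ?thesis using True \<chi>_eq \<alpha>_eq unfolding componentwise_def by simp
      next
        case False
        then show ?thesis using permutes_not_in[OF perm] unfolding componentwise_def by simp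
      qed
    qed
    ultimately show "\<exists>f\<in>automorphisms G. \<exists>g\<in>automorphisms K2. \<chi> = componentwise G K2 f g" by blast
  qed
qed

text \<open>A two-fold automorphism of \<open>G\<close> twists the product with \<open>H\<close>
  through the colouring. Both colours occur in \<open>H\<close>, so a componentwise form makes the
  two permutations equal.\<close>

lemma (in coloured_pair) stable_pair_imp_stable_graph:
  assumes "stable_pair G H" shows "stable_graph G"
  unfolding stable_graph_iff
proof (intro allI impI)
  fix \<alpha>
  assume bij: "\<forall>b. bij_betw (\<alpha> b) (pverts G) (pverts G)"
    and adj: "\<forall>b. \<forall>u\<in>pverts G. \<forall>v\<in>pverts G. (\<alpha> b u, \<alpha> (\<not> b) v) \<in> parcs G \<longleftrightarrow> (u, v) \<in> parcs G"
  define \<chi> where "\<chi> = (\<lambda>p. if p \<in> pverts (G \<times>\<^sub>g H) then (\<alpha> (c (snd p)) (fst p), snd p) else p)"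
  have "\<chi> \<in> automorphisms (G \<times>\<^sub>g H)"
    unfolding \<chi>_def by (rule twist_automorphism) (use bij adj in blast)+
  then obtain f g where eq: "\<chi> = componentwise G H f g"
    using assms unfolding stable_pair_iff by blast
  have "\<alpha> b u = f u" if u: "u \<in> pverts G" for u b
  proof -
    obtain s where "s \<in> pverts H" "c s = b" using colour_nonempty[of b] arc_H by blast
    then show ?thesis
      using fun_cong[OF eq, of "(u, s)"] u
      unfolding \<chi>_def componentwise_def by (simp add: pverts_direct_product)
  qed
  then show "\<forall>u\<in>pverts G. \<alpha> True u = \<alpha> False u" by simp
qed

lemma (in coloured_pair) stable_graph_imp_stable_pair:
  assumes st: "stable_graph G" and "twin_free G" "twin_free H" "factor_loopless G"
    and cop: "graph_coprime G H"
  shows "stable_pair G H"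
  unfolding stable_pair_iff
proof
  fix \<phi> assume \<phi>: "\<phi> \<in> automorphisms (G \<times>\<^sub>g H)"
  note perm = automorphismsD(1)[OF \<phi>]
  interpret pair_automorphism G H c \<phi> by unfold_locales (use \<phi> assms in auto)
  obtain \<alpha> g where \<phi>_eq: "\<And>u s. u \<in> pverts G \<Longrightarrow> s \<in> pverts H \<Longrightarrow> \<phi> (u, s) = (\<alpha> (c s) u, g s)"
    and bij: "\<And>b. bij_betw (\<alpha> b) (pverts G) (pverts G)"
    using coordinates_preserved[OF cop] by blast
  have arc: "(\<alpha> (c s) u, \<alpha> (c t) v) \<in> parcs G \<and> (g s, g t) \<in> parcs H \<longleftrightarrow> (u, v) \<in> parcs G \<and> (s, t) \<in> parcs H"
    if "u \<in> pverts G" "v \<in> pverts G" "s \<in> pverts H" "t \<in> pverts H" for u v s t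
    using automorphismsD(2)[OF \<phi>, of "(u, s)" "(v, t)"] that
    by (simp add: \<phi>_eq pverts_direct_product parcs_direct_product)
  obtain a b where ab: "(a, b) \<in> parcs G" using arcs_G by auto
  note V = arc_G[OF ab]
  have adj: "(\<alpha> d u, \<alpha> (\<not> d) v) \<in> parcs G \<longleftrightarrow> (u, v) \<in> parcs G"
    if "u \<in> pverts G" "v \<in> pverts G" for d u v
  proof -
    obtain s t where st: "(s, t) \<in> parcs H" "c s = d" "c t = (\<not> d)" using colour_nonempty by blast
    \<comment> \<open>Testing \<open>arc\<close> on the arc \<open>(a, b)\<close> of
      \<open>G\<close> settles the second coordinates; what remains is a statement about
      \<open>\<alpha>\<close> alone.\<close>
    have "(g s, g t) \<in> parcs H" using arc[OF V arc_H[OF st(1)]] ab st by blast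
    then show ?thesis using arc[OF that arc_H[OF st(1)]] st by simp
  qed
  have "\<alpha> True u = \<alpha> False u" if "u \<in> pverts G" for u
    using st bij adj that unfolding stable_graph_iff by blast
  note same = this
  define f where "f u = (if u \<in> pverts G then \<alpha> True u else u)" for u
  have \<alpha>_eq: "\<alpha> b u = f u" if "u \<in> pverts G" for b u
    using same[OF that] that by (cases b) (auto simp: f_def)
  have "bij_betw f (pverts G) (pverts G)"
    by (subst bij_betw_cong[where g = "\<alpha> True"]) (auto simp: f_def bij)
  then have "f permutes pverts G" by (rule bij_imp_permutes) (simp add: f_def)
  then have f: "f \<in> automorphisms G"
    using adj[of _ _ True] \<alpha>_eq unfolding automorphisms_def by simp
  define g' where "g' s = (if s \<in> pverts H then g s else s)" for s
  have g_in: "g s \<in> pverts H" if "s \<in> pverts H" for s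
    using \<phi>_in[of "(a, s)"] that V by (simp add: \<phi>_eq pair_in_Z)
  have g_adj: "(g s, g t) \<in> parcs H \<longleftrightarrow> (s, t) \<in> parcs H" if "s \<in> pverts H" "t \<in> pverts H" for s t
  proof -
    have "(\<alpha> (c s) a, \<alpha> (c t) b) \<in> parcs G" using adj[OF V, of True] ab \<alpha>_eq V by simp
    then show ?thesis using arc[OF V that] ab by blast
  qed
  have "inj_on g' (pverts H)"
  proof (rule inj_onI)
    fix s t assume *: "s \<in> pverts H" "t \<in> pverts H" "g' s = g' t"
    then have "\<phi> (a, s) = \<phi> (a, t)" using \<phi>_eq V \<alpha>_eq by (simp add: g'_def)
    then show "s = t" using injD[OF permutes_inj[OF perm]] by blast
  qed
  moreover have "finite (pverts H)" using graphs unfolding pseudo_graph_iff by blast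
  moreover have "g' ` pverts H \<subseteq> pverts H" using g_in by (auto simp: g'_def)
  ultimately have "bij_betw g' (pverts H) (pverts H)"
    unfolding bij_betw_def using endo_inj_surj by blast
  then have "g' permutes pverts H" by (rule bij_imp_permutes) (simp add: g'_def)
  then have g': "g' \<in> automorphisms H" using g_adj unfolding automorphisms_def g'_def by simp
  have "\<phi> = componentwise G H f g'"
  proof
    fix p show "\<phi> p = componentwise G H f g' p"
    proof (cases "p \<in> pverts (G \<times>\<^sub>g H)")
      case True
      then obtain u s where "p = (u, s)" "u \<in> pverts G" "s \<in> pverts H"
        by (auto simp: pverts_direct_product)
      then show ?thesis using True \<phi>_eq \<alpha>_eq unfolding componentwise_def g'_def by simp
    next
      case False
      then show ?thesis using permutes_not_in[OF perm] unfolding componentwise_def by simp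
    qed
  qed
  then show "\<exists>f\<in>automorphisms G. \<exists>g\<in>automorphisms H. \<phi> = componentwise G H f g"
    using f g' by blast
qed

theorem theorem1p3:
  fixes \<Gamma> :: "'a pair_pre_digraph" and \<Sigma> :: "'b pair_pre_digraph"
  assumes "nontrivial_pair \<Gamma> \<Sigma>"
    and "\<not> bipartite \<Gamma>" and "factor_loopless \<Gamma>"
    and "bipartite \<Sigma>"
  shows "stable_pair \<Gamma> \<Sigma> \<longleftrightarrow> stable_graph \<Gamma>"
proof -
  have P: "pair_pseudo_graph \<Gamma>" "pair_pseudo_graph \<Sigma>"
    using assms(1) pair_graph.axioms(2) unfolding nontrivial_pair_def by blast+
  obtain c :: "'b \<Rightarrow> bool" where c: "\<forall>(s, t)\<in>parcs \<Sigma>. c s \<noteq> c t"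
    using assms(4) unfolding bipartite_def by blast
  have conn: "connected (with_proj \<Gamma>)" "connected (with_proj \<Sigma>)"
    using assms(1) unfolding nontrivial_pair_def by blast+
  interpret coloured_pair \<Gamma> \<Sigma> c
  proof (rule coloured_pair.intro)
    show "\<exists>k. (u, v) \<in> parcs \<Gamma> ^^ (2 * k)" if "u \<in> pverts \<Gamma>" "v \<in> pverts \<Gamma>" for u v
      by (rule nonbipartite_even_walk[OF P(1) conn(1) assms(2) that])
    \<comment> \<open>Without arcs every colouring would be proper.\<close>
    show "parcs \<Gamma> \<noteq> {}" using assms(2) unfolding bipartite_def by auto
    show "(s, t) \<in> (parcs \<Sigma>)\<^sup>*" if "s \<in> pverts \<Sigma>" "t \<in> pverts \<Sigma>" for s t
      by (rule connected_walk[OF P(2) conn(2) that])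
    show "parcs \<Sigma> \<noteq> {}" using assms(1,4) unfolding nontrivial_pair_def by blast
    show "c s \<noteq> c t" if "(s, t) \<in> parcs \<Sigma>" for s t using c that by blast
  qed (fact P)+
  show ?thesis
    using stable_pair_imp_stable_graph stable_graph_imp_stable_pair assms
    unfolding nontrivial_pair_def by blast
qed

end
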